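(* For a positive integer $n$, let $H_{n}(x,y)$ denote the generating function $H_n(x,y)=\sum_{A} x^{r(A)}y^{s(A)}$, where the sum runs over all $n\times n$ alternating sign matrices $A=(a_{ij})_{0\le i,j\le n-1}$ that are invariant under the half-turn, i.e. satisfy $a_{ij}=a_{n-1-i,\,n-1-j}$ for all $i,j$; here $s(A)$ is the column index $s$ with $a_{0s}=1$, and $r(A)$ is the number of orbits of the entries equal to $-1$ under the action of the two-element group generated by the half-turn $(i,j)\mapsto(n-1-i,n-1-j)$. Then for every positive integer $n$, \[ \frac{H_{4n}(2,1)}{H_{4n-2}(2,1)}=2^{2n-1}\,\frac{\binom{4n}{2n}}{\binom{2n}{n}},\qquad \frac{H_{4n+2}(2,1)}{H_{4n}(2,1)}=2^{2n+1}\,\frac{\binom{4n}{2n}}{\binom{2n}{n}},\qquad H_{2n+1}(2,1)=2^{n}\,H_{2n}(2,1). \]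
   Context: An alternating sign matrix is a square matrix all of whose entries are $1$, $-1$ or $0$, every row and column has sum $1$, and in every row and column the non-zero entries alternate in sign. Entries of an $n\times n$ matrix are indexed $a_{ij}$ with $0\le i,j\le n-1$. Every alternating sign matrix has exactly one entry equal to $1$ in its top row (row $0$). Concretely, $r(A)$ equals half the number of $-1$ entries of $A$, except when $n=2m+1$ is odd and $a_{mm}=-1$, in which case the number of $-1$ entries is odd, say $2l+1$, and $r(A)=l+1$. *)

theory Defs
  imports "Jordan_Normal_Form.Matrix"
begin

definition alternating_signs :: "int vec \<Rightarrow> bool" where
  "alternating_signs v \<longleftrightarrow>
     (\<forall>j k. j < k \<and> k < dim_vec v \<and> v $ j \<noteq> 0 \<and> v $ k \<noteq> 0 \<and>
        (\<forall>l. j < l \<and> l < k \<longrightarrow> v $ l = 0) \<longrightarrow> sgn (v $ k) = - sgn (v $ j))"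

definition alternating_sign_matrix :: "nat \<Rightarrow> int mat \<Rightarrow> bool" where
  "alternating_sign_matrix n A \<longleftrightarrow>
     A \<in> carrier_mat n n \<and>
     (\<forall>i<n. \<forall>j<n. A $$ (i, j) \<in> {1, -1, 0}) \<and>
     (\<forall>i<n. (\<Sum>j<n. A $$ (i, j)) = 1) \<and>
     (\<forall>j<n. (\<Sum>i<n. A $$ (i, j)) = 1) \<and>
     (\<forall>i<n. alternating_signs (row A i)) \<and>
     (\<forall>j<n. alternating_signs (col A j))"

definition half_turn :: "nat \<Rightarrow> nat \<times> nat \<Rightarrow> nat \<times> nat" where
  "half_turn n = (\<lambda>(i, j). (n - 1 - i, n - 1 - j))"

definition half_turn_ASMs :: "nat \<Rightarrow> int mat set" where
  "half_turn_ASMs n =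
     {A. alternating_sign_matrix n A \<and>
         (\<forall>i<n. \<forall>j<n. A $$ (i, j) = A $$ half_turn n (i, j))}"

text \<open>Since the half-turn is an involution on positions, the orbit of a position
  \<open>p\<close> under the group it generates is \<open>{p, half_turn n p}\<close>.\<close>

definition minus_one_orbits :: "nat \<Rightarrow> int mat \<Rightarrow> nat" where
  "minus_one_orbits n A =
     card ((\<lambda>p. {p, half_turn n p}) ` {(i, j). i < n \<and> j < n \<and> A $$ (i, j) = -1})"

definition top_one_column :: "nat \<Rightarrow> int mat \<Rightarrow> nat" where
  "top_one_column n A = (THE s. s < n \<and> A $$ (0, s) = 1)"

text \<open>The generating function is a polynomial, given here by its evaluation at arbitrary
  points of any commutative semiring.\<close>

definition H :: "nat \<Rightarrow> 'a::comm_semiring_1 \<Rightarrow> 'a \<Rightarrow> 'a" where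
  "H n x y = (\<Sum>A\<in>half_turn_ASMs n. x ^ minus_one_orbits n A * y ^ top_one_column n A)"

end

theory Submission
  imports Defs "Jordan_Normal_Form.Determinant" "HOL-Computational_Algebra.Polynomial"
begin

text \<open>
  Let \<open>m = n div 2\<close>. A half-turn symmetric alternating sign matrix of order \<open>n\<close> is determined by its top
  \<open>m\<close> rows. Let \<open>T\<close> be the set of columns whose entries in these rows add up to 1. By
  the argument of Mills, Robbins and Rumsey, the top rows belonging to a fixed \<open>T\<close>, counted with weight 2 for
  each entry \<open>-1\<close>, contribute a constant times the product of differences \<open>\<Delta>(T)\<close>.

  If \<open>n = 2 * m\<close>, then \<open>T\<close> runs over the transversals of the pairs \<open>{j, n - 1 - j}\<close>. Centred at 0,
  these are the sets \<open>{e\<^sub>j * a\<^sub>j | j < m}\<close> with \<open>a\<^sub>j = j + 1/2\<close> and signs \<open>e\<^sub>j\<close>, and \<open>\<Delta>(T)\<close> is the determinant of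
  \<open>e\<^sub>j ^ j * (e\<^sub>j * a\<^sub>j) ^ l\<close>. Summing over the signs row by row annihilates the entries with \<open>j + l\<close> odd, and the
  remaining determinant is a product.

  If \<open>n = 2 * m + 1\<close>, the determinant of \<open>y\<^sub>i ^ l + (y\<^sub>i + 1) ^ l\<close> is \<open>2 ^ m * \<Delta>(Y)\<close>, and by
  multilinearity it is also the sum of \<open>\<Delta>(S)\<close> over all \<open>S\<close> with \<open>s\<^sub>i \<in> {y\<^sub>i, y\<^sub>i + 1}\<close>. Summing over the transversals \<open>Y\<close>, a set
  \<open>S\<close> that leads to an alternating middle row occurs \<open>2 ^ q\<close> times, where \<open>q\<close> is the number of orbits
  of \<open>-1\<close> in that row, and every other \<open>S\<close> does not occur. Hence the odd case is \<open>2 ^ m\<close> times the even one.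
\<close>

section \<open>Determinants of Vandermonde type\<close>

text \<open>Multilinearity in the rows: in the Leibniz formula a product over the rows of sums
  expands into a sum over choice functions \<open>g\<close>. This links sums over sets to single
  determinants.\<close>

lemma det_mat_sum_rows:
  fixes f :: "nat \<Rightarrow> 'b \<Rightarrow> nat \<Rightarrow> 'a::comm_ring_1"
  assumes "\<And>i. i < m \<Longrightarrow> finite (A i)"
  shows "det (mat m m (\<lambda>(i, l). \<Sum>s\<in>A i. f i s l)) =
    (\<Sum>g\<in>PiE {..<m} A. det (mat m m (\<lambda>(i, l). f i (g i) l)))"
proof -
  have lt: "p i < m" if "p permutes {0..<m}" "i < m" for p i
    using permutes_in_image[OF that(1), of i] that(2) by auto
  have L: "det (mat m m (\<lambda>(i, l). \<Sum>s\<in>A i. f i s l)) =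
    (\<Sum>p\<in>{p. p permutes {0..<m}}. signof p * (\<Sum>g\<in>PiE {..<m} A. \<Prod>i<m. f i (g i) (p i)))"
    (is "?l = _")
  proof -
    have "?l = (\<Sum>p\<in>{p. p permutes {0..<m}}. signof p * (\<Prod>i<m. \<Sum>s\<in>A i. f i s (p i)))"
      by (subst det_def'[of _ m]) (auto intro!: sum.cong prod.cong simp: lt atLeast0LessThan)
    also have "\<dots> = (\<Sum>p\<in>{p. p permutes {0..<m}}. signof p * (\<Sum>g\<in>PiE {..<m} A. \<Prod>i<m. f i (g i) (p i)))"
      by (intro sum.cong refl arg_cong2[where f = "(*)"] prod_sum_PiE) (use assms in auto)
    finally show ?thesis .
  qed
  have "(\<Sum>g\<in>PiE {..<m} A. det (mat m m (\<lambda>(i, l). f i (g i) l))) =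
    (\<Sum>g\<in>PiE {..<m} A. \<Sum>p\<in>{p. p permutes {0..<m}}. signof p * (\<Prod>i<m. f i (g i) (p i)))"
    by (intro sum.cong refl, subst det_def'[of _ m])
      (auto intro!: sum.cong prod.cong simp: lt atLeast0LessThan)
  also have "\<dots> = (\<Sum>p\<in>{p. p permutes {0..<m}}. signof p * (\<Sum>g\<in>PiE {..<m} A. \<Prod>i<m. f i (g i) (p i)))"
    by (subst sum.swap) (simp add: sum_distrib_left)
  finally show ?thesis using L by simp
qed

lemma det_mat_scale_rows:
  fixes f :: "nat \<Rightarrow> nat \<Rightarrow> 'a::comm_ring_1"
  shows "det (mat m m (\<lambda>(i, l). c i * f i l)) = (\<Prod>i<m. c i) * det (mat m m (\<lambda>(i, l). f i l))"
proof -
  have lt: "p i < m" if "p permutes {0..<m}" "i < m" for p i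
    using permutes_in_image[OF that(1), of i] that(2) by auto
  show ?thesis
    by (simp add: det_def'[of _ m] sum_distrib_left)
      (auto intro!: sum.cong simp: lt atLeast0LessThan prod.distrib mult_ac)
qed

text \<open>The matrix on the left arises by applying row functionals to the polynomials \<open>Q l\<close>,
  the one on the right by applying the same functionals to the monomials.\<close>

lemma det_mat_polynomial_columns:
  fixes f :: "nat \<Rightarrow> nat \<Rightarrow> 'a::comm_ring_1"
  assumes "\<And>l. l < m \<Longrightarrow> degree (Q l) \<le> l"
  shows "det (mat m m (\<lambda>(i, l). \<Sum>j<m. coeff (Q l) j * f i j)) =
    (\<Prod>l<m. coeff (Q l) l) * det (mat m m (\<lambda>(i, l). f i l))"
proof -
  let ?F = "mat m m (\<lambda>(i, l). f i l)" and ?U = "mat m m (\<lambda>(j, l). coeff (Q l) j)"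
  have "mat m m (\<lambda>(i, l). \<Sum>j<m. coeff (Q l) j * f i j) = ?F * ?U"
    by (intro eq_matI) (auto simp: scalar_prod_def atLeast0LessThan mult.commute)
  moreover have "det ?U = (\<Prod>l<m. coeff (Q l) l)"
  proof -
    have "upper_triangular ?U"
      using le_less_trans[OF assms] by (auto simp: upper_triangular_def intro!: coeff_eq_0)
    then have "det ?U = prod_list (diag_mat ?U)"
      by (rule det_upper_triangular[of _ m]) simp
    then show ?thesis by (simp add: prod_list_diag_prod atLeast0LessThan)
  qed
  ultimately show ?thesis
    by (simp add: det_mult[of _ m] mult.commute)
qed

definition vandermonde :: "nat \<Rightarrow> (nat \<Rightarrow> 'a::comm_ring_1) \<Rightarrow> 'a" where
  "vandermonde m x = det (mat m m (\<lambda>(i, l). x i ^ l))"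

lemma poly_eq_sum_lessThan:
  fixes p :: "'a::comm_semiring_1 poly"
  assumes "degree p < m"
  shows "poly p x = (\<Sum>j<m. coeff p j * x ^ j)"
proof -
  have "(\<Sum>j<m. coeff p j * x ^ j) = (\<Sum>j\<le>degree p. coeff p j * x ^ j)"
    using assms by (intro sum.mono_neutral_right) (auto simp: coeff_eq_0)
  then show ?thesis by (simp add: poly_altdef)
qed

text \<open>In the Newton basis \<open>Q l\<close> the matrix is lower triangular, because
  \<open>Q l\<close> vanishes at \<open>x i\<close> for \<open>i < l\<close>; each
  \<open>Q l\<close> is monic of degree \<open>l\<close>, so the change of basis preserves the
  determinant.\<close>

lemma vandermonde_eq_prod:
  fixes x :: "nat \<Rightarrow> 'a::idom"
  shows "vandermonde m x = (\<Prod>j<m. \<Prod>i<j. x j - x i)"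
proof -
  define Q where "Q l = (\<Prod>i<l. [:- x i, 1:])" for l :: nat
  have deg: "degree (Q l) = l" for l
    unfolding Q_def by (subst degree_prod_eq_sum_degree) auto
  have lead: "coeff (Q l) l = 1" for l
    using lead_coeff_prod[of "\<lambda>i. [:- x i, 1:]" "{..<l}"] deg[of l] by (simp add: Q_def)
  have "det (mat m m (\<lambda>(i, l). poly (Q l) (x i))) = vandermonde m x"
  proof -
    have "mat m m (\<lambda>(i, l). poly (Q l) (x i)) = mat m m (\<lambda>(i, l). \<Sum>j<m. coeff (Q l) j * x i ^ j)"
      by (intro eq_matI) (auto simp: deg intro!: poly_eq_sum_lessThan)
    then show ?thesis
      unfolding vandermonde_def by (simp add: det_mat_polynomial_columns deg lead)
  qed
  moreover have "det (mat m m (\<lambda>(i, l). poly (Q l) (x i))) = (\<Prod>j<m. \<Prod>i<j. x j - x i)"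
  proof -
    have "det (mat m m (\<lambda>(i, l). poly (Q l) (x i))) =
        prod_list (diag_mat (mat m m (\<lambda>(i, l). poly (Q l) (x i))))"
      by (rule det_lower_triangular[of m]) (auto simp: Q_def poly_prod intro!: prod_zero)
    then show ?thesis
      by (simp add: prod_list_diag_prod atLeast0LessThan Q_def poly_prod)
  qed
  ultimately show ?thesis by simp
qed

lemma det_mat_power_diff:
  fixes x :: "nat \<Rightarrow> 'a::idom"
  shows "det (mat k k (\<lambda>(i, l). x (Suc i) ^ Suc l - x i ^ Suc l)) = vandermonde (Suc k) x"
proof -
  \<comment> \<open>\<open>?D\<close> subtracts from each row the row above it. The first column of
    the product is then 1 followed by zeros, and expanding along it leaves the differences of
    powers.\<close>
  let ?D = "mat (Suc k) (Suc k) (\<lambda>(i, j). if j = i then 1 else if i = Suc j then - 1 else 0 :: 'a)"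
  let ?V = "mat (Suc k) (Suc k) (\<lambda>(i, l). x i ^ l)"
  have "det ?D = 1"
    by (subst det_lower_triangular[of "Suc k"]) (auto simp: prod_list_diag_prod)
  moreover have "det (?D * ?V) = det ?D * det ?V"
    by (rule det_mult[of _ "Suc k"]) auto
  moreover have ent: "(?D * ?V) $$ (i, l) = (if i = 0 then x 0 ^ l else x i ^ l - x (i - 1) ^ l)"
    if "i < Suc k" "l < Suc k" for i l
  proof -
    have "(?D * ?V) $$ (i, l) = (\<Sum>j<Suc k. (if j = i then 1 else if i = Suc j then - 1 else 0) * x j ^ l)"
      using that by (simp add: scalar_prod_def atLeast0LessThan)
    also have "\<dots> = (\<Sum>j<Suc k. (if j = i then x j ^ l else 0) - (if i = Suc j then x j ^ l else 0))"
      by (intro sum.cong) auto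
    also have "\<dots> = x i ^ l - (\<Sum>j<Suc k. if i = Suc j then x j ^ l else 0)"
      using that by (simp add: sum_subtractf sum.delta)
    also have "(\<Sum>j<Suc k. if i = Suc j then x j ^ l else 0) = (if i = 0 then 0 else x (i - 1) ^ l)"
    proof (cases i)
      case (Suc i')
      then have "(\<Sum>j<Suc k. if i = Suc j then x j ^ l else 0) = (\<Sum>j<Suc k. if j = i' then x j ^ l else 0)"
        by (intro sum.cong) auto
      then show ?thesis using Suc that by simp
    qed simp
    finally show ?thesis by simp
  qed
  moreover have "det (?D * ?V) = det (mat k k (\<lambda>(i, l). x (Suc i) ^ Suc l - x i ^ Suc l))"
  proof -
    have "det (?D * ?V) = (\<Sum>i<Suc k. (?D * ?V) $$ (i, 0) * cofactor (?D * ?V) i 0)"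
      by (rule laplace_expansion_column) auto
    also have "\<dots> = (\<Sum>i<Suc k. if i = 0 then cofactor (?D * ?V) i 0 else 0)"
      by (intro sum.cong refl, subst ent) auto
    also have "\<dots> = det (mat_delete (?D * ?V) 0 0)"
      by (simp add: cofactor_def sum.delta)
    also have "mat_delete (?D * ?V) 0 0 = mat k k (\<lambda>(i, l). x (Suc i) ^ Suc l - x i ^ Suc l)"
      by (intro eq_matI) (auto simp: mat_delete_def ent simp del: index_mult_mat(1))
    finally show ?thesis .
  qed
  ultimately show ?thesis by (simp add: vandermonde_def)
qed

lemma det_mat_sum_poly:
  fixes x :: "'b \<Rightarrow> 'a::comm_ring_1"
  assumes "\<And>l. l < m \<Longrightarrow> degree (Q l) \<le> l"
  shows "det (mat m m (\<lambda>(i, l). \<Sum>s\<in>A i. poly (Q l) (x s))) =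
    (\<Prod>l<m. coeff (Q l) l) * det (mat m m (\<lambda>(i, l). \<Sum>s\<in>A i. x s ^ l))"
proof -
  have "mat m m (\<lambda>(i, l). \<Sum>s\<in>A i. poly (Q l) (x s)) =
      mat m m (\<lambda>(i, l). \<Sum>j<m. coeff (Q l) j * (\<Sum>s\<in>A i. x s ^ j))"
  proof (intro eq_matI)
    fix i l assume "i < dim_row (mat m m (\<lambda>(i, l). \<Sum>j<m. coeff (Q l) j * (\<Sum>s\<in>A i. x s ^ j)))"
      "l < dim_col (mat m m (\<lambda>(i, l). \<Sum>j<m. coeff (Q l) j * (\<Sum>s\<in>A i. x s ^ j)))"
    then have il: "i < m" "l < m" by auto
    have "(\<Sum>s\<in>A i. poly (Q l) (x s)) = (\<Sum>s\<in>A i. \<Sum>j<m. coeff (Q l) j * x s ^ j)"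
      using il assms[of l] by (intro sum.cong refl poly_eq_sum_lessThan) simp
    also have "\<dots> = (\<Sum>j<m. coeff (Q l) j * (\<Sum>s\<in>A i. x s ^ j))"
      by (subst sum.swap) (simp add: sum_distrib_left)
    finally show "mat m m (\<lambda>(i, l). \<Sum>s\<in>A i. poly (Q l) (x s)) $$ (i, l) =
      mat m m (\<lambda>(i, l). \<Sum>j<m. coeff (Q l) j * (\<Sum>s\<in>A i. x s ^ j)) $$ (i, l)"
      using il by simp
  qed auto
  then show ?thesis
    using det_mat_polynomial_columns[OF assms, of m "\<lambda>i j. \<Sum>s\<in>A i. x s ^ j"] by simp
qed

text \<open>The polynomial \<open>x ^ l + (x + 1) ^ l\<close> has degree at most \<open>l\<close>
  and coefficient 2 at \<open>x ^ l\<close>, so each of the \<open>m\<close> columns gives a factor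
  2.\<close>

lemma det_mat_sum_adjacent_powers:
  fixes x :: "'b \<Rightarrow> 'a::comm_ring_1"
  shows "det (mat m m (\<lambda>(i, l). \<Sum>s\<in>A i. x s ^ l + (x s + 1) ^ l)) =
    2 ^ m * det (mat m m (\<lambda>(i, l). \<Sum>s\<in>A i. x s ^ l))"
proof -
  define Q :: "nat \<Rightarrow> 'a poly" where "Q l = monom 1 l + [:1, 1:] ^ l" for l
  have "degree (Q l) \<le> l" for l
    unfolding Q_def using degree_power_le[of "[:1, 1 :: 'a:]" l]
    by (intro degree_add_le degree_monom_le) simp
  moreover have "coeff (Q l) l = 2" for l
    by (simp add: Q_def coeff_linear_poly_power)
  moreover have "poly (Q l) y = y ^ l + (y + 1) ^ l" for l y
    by (simp add: Q_def poly_monom add.commute)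
  ultimately show ?thesis
    using det_mat_sum_poly[where m = m and Q = Q and A = A and x = x] by simp
qed

text \<open>The difference has degree at most \<open>l\<close> and coefficient \<open>Suc l\<close>
  at \<open>x ^ l\<close>, whence the factorial.\<close>

lemma det_mat_sum_power_step:
  fixes x :: "'b \<Rightarrow> 'a::{comm_ring_1, ring_char_0}"
  shows "det (mat m m (\<lambda>(i, l). \<Sum>s\<in>A i. (x s + 1) ^ Suc l - x s ^ Suc l)) =
    fact m * det (mat m m (\<lambda>(i, l). \<Sum>s\<in>A i. x s ^ l))"
proof -
  define Q :: "nat \<Rightarrow> 'a poly" where "Q l = [:1, 1:] ^ Suc l - monom 1 (Suc l)" for l
  have co: "coeff (Q l) j = (if j = Suc l then 0 else of_nat (Suc l choose j))" for l j
    by (cases "j \<le> Suc l")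
      (auto simp: Q_def coeff_linear_poly_power degree_linear_power coeff_eq_0 simp del: power_Suc)
  have "degree (Q l) \<le> l" for l
    by (rule degree_le) (auto simp: co)
  moreover have "(\<Prod>l<m. coeff (Q l) l) = fact m"
    by (simp add: co fact_prod_Suc atLeast0LessThan)
  moreover have "poly (Q l) y = (y + 1) ^ Suc l - y ^ Suc l" for l y
    by (simp add: Q_def poly_monom algebra_simps)
  ultimately show ?thesis
    using det_mat_sum_poly[where m = m and Q = Q and A = A and x = x] by simp
qed

section \<open>Difference products over interlacing sets\<close>

definition enum :: "nat set \<Rightarrow> nat \<Rightarrow> nat" where
  "enum S i = sorted_list_of_set S ! i"

lemma enum_strict_mono:
  "finite S \<Longrightarrow> i < j \<Longrightarrow> j < card S \<Longrightarrow> enum S i < enum S j"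
  unfolding enum_def
  by (metis sorted_wrt_nth_less strict_sorted_list_of_set length_sorted_list_of_set)

lemma enum_image: "finite S \<Longrightarrow> enum S ` {..<card S} = S"
  unfolding enum_def
  by (metis length_sorted_list_of_set lessThan_atLeast0 list.set_map map_nth set_sorted_list_of_set set_upt)

lemma enum_mem: "finite S \<Longrightarrow> i < card S \<Longrightarrow> enum S i \<in> S"
  using enum_image by blast

lemma enum_inj_on: "finite S \<Longrightarrow> inj_on (enum S) {..<card S}"
  by (rule linorder_inj_onI) (use enum_strict_mono in \<open>force+\<close>)

lemma enum_unique:
  assumes "strict_mono_on {..<k} g" "i < k"
  shows "enum (g ` {..<k}) i = g i"
proof -
  have "sorted_wrt (<) (map g [0..<k])"
    using assms(1) by (auto simp: sorted_wrt_iff_nth_less strict_mono_on_def)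
  then have "sorted_list_of_set (g ` {..<k}) = map g [0..<k]"
    using sorted_list_of_set_unique[of "g ` {..<k}" "map g [0..<k]"]
      card_image[OF strict_mono_on_imp_inj_on[OF assms(1)]]
    by (simp add: atLeast0LessThan)
  then show ?thesis using assms(2) by (simp add: enum_def)
qed

text \<open>Dictionary between positions and counts: interlacing and half steps are defined by
  counts, while the determinants need bounds on the \<open>i\<close>-th element.\<close>

lemma enum_less_iff:
  assumes "finite S" "i < card S"
  shows "enum S i < j \<longleftrightarrow> i < card (S \<inter> {..<j})"
proof
  assume "enum S i < j"
  have "enum S ` {..i} \<subseteq> S \<inter> {..<j}"
  proof safe
    fix i' assume "i' \<le> i"
    then show "enum S i' \<in> S" "enum S i' < j"
      using enum_mem[OF assms(1), of i'] enum_strict_mono[OF assms(1), of i' i] assms(2) \<open>enum S i < j\<close>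
      by (auto simp: le_less)
  qed
  moreover have "card (enum S ` {..i}) = Suc i"
  proof -
    have "{..i} \<subseteq> {..<card S}" using assms(2) by auto
    then show ?thesis
      using card_image[OF inj_on_subset[OF enum_inj_on[OF assms(1)]]] by simp
  qed
  ultimately show "i < card (S \<inter> {..<j})"
    using card_mono[of "S \<inter> {..<j}" "enum S ` {..i}"] assms(1) by simp
next
  assume less: "i < card (S \<inter> {..<j})"
  show "enum S i < j"
  proof (rule ccontr)
    assume "\<not> enum S i < j"
    have "S \<inter> {..<j} \<subseteq> enum S ` {..<i}"
    proof
      fix s assume s: "s \<in> S \<inter> {..<j}"
      then obtain i' where "i' < card S" "s = enum S i'"
        using enum_image[OF assms(1)] by blast
      moreover from this have "i' < i"
        using s \<open>\<not> enum S i < j\<close> enum_strict_mono[OF assms(1), of i i'] assms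
        by (metis IntE lessThan_iff less_trans linorder_neqE_nat)
      ultimately show "s \<in> enum S ` {..<i}" by auto
    qed
    then have "card (S \<inter> {..<j}) \<le> card (enum S ` {..<i})"
      by (intro card_mono) auto
    also have "\<dots> \<le> i"
      using card_image_le[of "{..<i}" "enum S"] by simp
    finally show False using less by simp
  qed
qed

definition difference_product :: "nat set \<Rightarrow> rat" where
  "difference_product T = (\<Prod>t\<in>T. \<Prod>s\<in>{s \<in> T. s < t}. of_nat t - of_nat s)"

text \<open>Absolute values make the new factors independent of the place of \<open>x\<close> in
  \<open>T\<close>, so a set may be built up in any order.\<close>

lemma difference_product_insert:
  assumes "finite T" "x \<notin> T"
  shows "difference_product (insert x T) = difference_product T * (\<Prod>t\<in>T. \<bar>of_nat x - of_nat t\<bar>)"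
proof -
  have "(\<Prod>s\<in>{s \<in> insert x T. s < t}. of_nat t - of_nat s) =
      (if x < t then \<bar>of_nat x - of_nat t\<bar> else 1) * (\<Prod>s\<in>{s \<in> T. s < t}. of_nat t - of_nat s :: rat)"
    if "t \<in> T" for t
  proof (cases "x < t")
    case True
    then have "{s \<in> insert x T. s < t} = insert x {s \<in> T. s < t}" by auto
    then show ?thesis using True assms by simp
  next
    case False
    then have "{s \<in> insert x T. s < t} = {s \<in> T. s < t}" by auto
    then show ?thesis using False by simp
  qed
  moreover have "(\<Prod>s\<in>{s \<in> insert x T. s < x}. of_nat x - of_nat s) =
      (\<Prod>t\<in>T. if x < t then 1 else \<bar>of_nat x - of_nat t\<bar> :: rat)"
  proof -
    have "{s \<in> insert x T. s < x} = {s \<in> T. s < x}" by auto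
    then have "(\<Prod>s\<in>{s \<in> insert x T. s < x}. of_nat x - of_nat s) =
        (\<Prod>s\<in>T. if s < x then of_nat x - of_nat s else 1 :: rat)"
      using prod.inter_filter[OF assms(1)] by simp
    also have "\<dots> = (\<Prod>t\<in>T. if x < t then 1 else \<bar>of_nat x - of_nat t\<bar>)"
      using assms by (intro prod.cong refl) (auto simp: not_less le_less)
    finally show ?thesis .
  qed
  ultimately have "difference_product (insert x T) =
      (\<Prod>t\<in>T. if x < t then 1 else \<bar>of_nat x - of_nat t\<bar>) *
      (\<Prod>t\<in>T. (if x < t then \<bar>of_nat x - of_nat t\<bar> else 1) * (\<Prod>s\<in>{s \<in> T. s < t}. of_nat t - of_nat s))"
    unfolding difference_product_def using assms by (simp cong: prod.cong)
  also have "\<dots> = difference_product T * (\<Prod>t\<in>T. (if x < t then 1 else \<bar>of_nat x - of_nat t\<bar>) *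
      (if x < t then \<bar>of_nat x - of_nat t\<bar> else 1))"
    unfolding difference_product_def prod.distrib by (simp add: mult_ac)
  also have "(\<Prod>t\<in>T. (if x < t then 1 else \<bar>of_nat x - of_nat t\<bar>) *
      (if x < t then \<bar>of_nat x - of_nat t\<bar> else 1)) = (\<Prod>t\<in>T. \<bar>of_nat x - of_nat t\<bar> :: rat)"
    by (intro prod.cong) auto
  finally show ?thesis .
qed

text \<open>No monotonicity is assumed, because transversals are listed by distance from the centre
  and not by size.\<close>

lemma difference_product_image:
  fixes h :: "nat \<Rightarrow> nat"
  assumes "inj_on h {..<m}"
  shows "difference_product (h ` {..<m}) = (\<Prod>j<m. \<Prod>i<j. \<bar>of_nat (h j) - of_nat (h i)\<bar>)"
  using assms
proof (induction m)
  case 0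
  then show ?case by (simp add: difference_product_def)
next
  case (Suc m)
  then have "inj_on h {..<m}" "h m \<notin> h ` {..<m}"
    by (auto simp: lessThan_Suc)
  then show ?case
    using Suc.IH by (simp add: lessThan_Suc difference_product_insert prod.reindex mult.commute)
qed

lemma difference_product_strict_mono:
  assumes "strict_mono_on {..<m} h"
  shows "difference_product (h ` {..<m}) = vandermonde m (\<lambda>i. of_nat (h i))"
proof -
  have "(\<Prod>j<m. \<Prod>i<j. \<bar>of_nat (h j) - of_nat (h i)\<bar>) = (\<Prod>j<m. \<Prod>i<j. of_nat (h j) - of_nat (h i) :: rat)"
    using strict_mono_onD[OF assms] by (intro prod.cong refl) force
  then show ?thesis
    using difference_product_image[OF strict_mono_on_imp_inj_on[OF assms]] by (simp add: vandermonde_eq_prod)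
qed

lemma vandermonde_eq_0:
  fixes x :: "nat \<Rightarrow> 'a::idom"
  assumes "i < j" "j < m" "x i = x j"
  shows "vandermonde m x = 0"
proof -
  have "(\<Prod>i<j. x j - x i) = 0"
    by (rule prod_zero, simp, rule bexI[of _ i]) (use assms in simp_all)
  then show ?thesis
    unfolding vandermonde_eq_prod
    by (intro prod_zero, simp, intro bexI[of _ j]) (use assms in simp_all)
qed

text \<open>The condition on \<open>hi\<close> and \<open>lo\<close> forces the choices \<open>g\<close> to be weakly increasing; those that are
  not strictly increasing have a vanishing Vandermonde determinant.\<close>

lemma sum_PiE_vandermonde:
  fixes lo hi :: "nat \<Rightarrow> nat" and w :: "nat \<Rightarrow> nat \<Rightarrow> rat"
  assumes "\<And>i. Suc i < k \<Longrightarrow> hi i \<le> lo (Suc i)"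
  shows "(\<Sum>g\<in>PiE {..<k} (\<lambda>i. {lo i..hi i}). (\<Prod>i<k. w i (g i)) * vandermonde k (\<lambda>i. of_nat (g i))) =
    (\<Sum>S | finite S \<and> card S = k \<and> (\<forall>i<k. lo i \<le> enum S i \<and> enum S i \<le> hi i).
      (\<Prod>i<k. w i (enum S i)) * difference_product S)"
    (is "sum ?F ?P = sum ?G ?S")
proof -
  let ?M = "{g \<in> ?P. strict_mono_on {..<k} g}"
  have mono: "strict_mono_on {..<k} g" if "g \<in> ?P" "vandermonde k (\<lambda>i. of_nat (g i) :: rat) \<noteq> 0" for g
  proof -
    have step: "g i < g (Suc i)" if "Suc i < k" for i
    proof -
      have "g i \<le> hi i" "lo (Suc i) \<le> g (Suc i)"
        using \<open>g \<in> ?P\<close> that by (auto simp: PiE_iff)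
      moreover have "g i \<noteq> g (Suc i)"
        using vandermonde_eq_0[of i "Suc i" k "\<lambda>i. of_nat (g i) :: rat"] that
          \<open>vandermonde k (\<lambda>i. of_nat (g i) :: rat) \<noteq> 0\<close> by auto
      ultimately show ?thesis using assms[OF that] by simp
    qed
    show ?thesis
    proof (rule strict_mono_onI)
      fix a b assume "a \<in> {..<k}" "b \<in> {..<k}" "a < b"
      then have "a < b \<and> b < k" by simp
      then show "g a < g b"
      proof (induction b)
        case (Suc b)
        then show ?case using step[of b] by (cases "a = b") auto
      qed simp
    qed
  qed
  have "sum ?F ?P = sum ?F ?M"
    using mono by (intro sum.mono_neutral_right) (auto intro!: finite_PiE)
  also have "\<dots> = sum ?G ?S"
  proof (rule sum.reindex_bij_witness[where j = "\<lambda>g. g ` {..<k}" and i = "\<lambda>S. restrict (enum S) {..<k}"])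
    fix g assume g: "g \<in> ?M"
    then have mg: "strict_mono_on {..<k} g" by simp
    show "restrict (enum (g ` {..<k})) {..<k} = g"
      using g by (auto simp: fun_eq_iff enum_unique[OF mg] PiE_iff extensional_def)
    show "g ` {..<k} \<in> ?S"
      using g by (auto simp: enum_unique[OF mg] PiE_iff card_image[OF strict_mono_on_imp_inj_on[OF mg]])
    show "?G (g ` {..<k}) = ?F g"
      using enum_unique[OF mg] by (auto simp: difference_product_strict_mono[OF mg])
  next
    fix S assume S: "S \<in> ?S"
    then show "restrict (enum S) {..<k} ` {..<k} = S"
      using enum_image[of S] by auto
    show "restrict (enum S) {..<k} \<in> ?M"
      using S by (auto intro!: strict_mono_onI intro: enum_strict_mono)
  qed
  finally show ?thesis .
qed

text \<open>Counts are compared because their difference is a prefix sum of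
  \<open>next_row S T\<close>. For finite sets with \<open>card T = Suc (card S)\<close> this is
  weak interlacing of the increasing enumerations, see \<open>interlacing_iff_enum\<close>.\<close>

definition interlacing :: "nat set \<Rightarrow> nat set \<Rightarrow> bool" where
  "interlacing S T \<longleftrightarrow>
     (\<forall>j. card (S \<inter> {..<j}) \<le> card (T \<inter> {..<j}) \<and> card (T \<inter> {..<j}) \<le> Suc (card (S \<inter> {..<j})))"

lemma card_Int_lessThan_le: "finite S \<Longrightarrow> card (S \<inter> {..<j}) \<le> card S"
  by (simp add: card_mono)

lemma interlacing_iff_enum:
  assumes S: "finite S" "card S = k" and T: "finite T" "card T = Suc k"
  shows "interlacing S T \<longleftrightarrow> (\<forall>i<k. enum T i \<le> enum S i \<and> enum S i \<le> enum T (Suc i))"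
proof
  assume il: "interlacing S T"
  show "\<forall>i<k. enum T i \<le> enum S i \<and> enum S i \<le> enum T (Suc i)"
  proof (intro allI impI conjI)
    fix i assume i: "i < k"
    have "i < card (S \<inter> {..<Suc (enum S i)})"
      using enum_less_iff[OF S(1), of i "Suc (enum S i)"] S i by simp
    also have "\<dots> \<le> card (T \<inter> {..<Suc (enum S i)})"
      using il by (simp add: interlacing_def)
    finally show "enum T i \<le> enum S i"
      using enum_less_iff[OF T(1), of i "Suc (enum S i)"] T i by simp
    have "Suc i < card (T \<inter> {..<Suc (enum T (Suc i))})"
      using enum_less_iff[OF T(1), of "Suc i" "Suc (enum T (Suc i))"] T i by simp
    also have "\<dots> \<le> Suc (card (S \<inter> {..<Suc (enum T (Suc i))}))"
      using il by (simp add: interlacing_def)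
    finally show "enum S i \<le> enum T (Suc i)"
      using enum_less_iff[OF S(1), of i "Suc (enum T (Suc i))"] S i by simp
  qed
next
  assume il: "\<forall>i<k. enum T i \<le> enum S i \<and> enum S i \<le> enum T (Suc i)"
  show "interlacing S T"
    unfolding interlacing_def
  proof (intro allI conjI)
    fix j
    show "card (S \<inter> {..<j}) \<le> card (T \<inter> {..<j})"
    proof (cases "card (S \<inter> {..<j})")
      case (Suc i)
      then have i: "i < k" using card_Int_lessThan_le[OF S(1), of j] S by simp
      then have "enum S i < j" using enum_less_iff[OF S(1), of i j] S Suc by simp
      then have "enum T i < j" using il i by (meson le_less_trans)
      then show ?thesis using enum_less_iff[OF T(1), of i j] T i Suc by simp
    qed simp
    show "card (T \<inter> {..<j}) \<le> Suc (card (S \<inter> {..<j}))"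
    proof (rule ccontr)
      assume "\<not> ?thesis"
      then obtain i where i: "card (T \<inter> {..<j}) = Suc (Suc i)" "card (S \<inter> {..<j}) \<le> i"
        by (metis Suc_le_D Suc_le_mono not_less_eq_eq)
      then have "Suc i < card T" using card_Int_lessThan_le[OF T(1), of j] by simp
      then have "enum T (Suc i) < j" using enum_less_iff[OF T(1), of "Suc i" j] i by simp
      then have "enum S i < j" using il[rule_format, of i] \<open>Suc i < card T\<close> T by simp
      then show False using enum_less_iff[OF S(1), of i j] S i \<open>Suc i < card T\<close> T by simp
    qed
  qed
qed

text \<open>Summing \<open>p s + p (Suc s)\<close> meets every inner point twice and the two end
  points once. This turns the weight 2 of inner points into the polynomials
  \<open>x ^ l + (x + 1) ^ l\<close>.\<close>

lemma sum_endpoint_weights: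
  fixes p :: "nat \<Rightarrow> 'a::comm_ring_1"
  assumes "a < b"
  shows "(\<Sum>s\<in>{a..b}. (if s = a \<or> s = b then 1 else 2) * p s) = (\<Sum>s\<in>{a..<b}. p s + p (Suc s))"
  using Suc_leI[OF assms]
proof (induction b rule: dec_induct)
  case base
  then show ?case by (simp add: atLeastAtMostSuc_conv)
next
  case (step b)
  \<comment> \<open>When the right end moves from \<open>b\<close> to \<open>Suc b\<close>, the
    point \<open>b\<close> becomes inner and its weight rises from 1 to 2.\<close>
  have "(\<Sum>s\<in>{a..b}. (if s = a \<or> s = Suc b then 1 else 2) * p s) =
      (\<Sum>s\<in>{a..b}. (if s = a \<or> s = b then 1 else 2) * p s + (if s = b then p s else 0))"
    using step by (intro sum.cong) (auto simp: algebra_simps)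
  also have "\<dots> = (\<Sum>s\<in>{a..<b}. p s + p (Suc s)) + p b"
    using step by (simp add: sum.distrib)
  finally show ?case
    using step by (simp add: atLeastAtMostSuc_conv add_ac)
qed

lemma sum_PiE_weighted_vandermonde:
  fixes x :: "nat \<Rightarrow> 'a::comm_ring_1"
  assumes "\<And>i. i < k \<Longrightarrow> finite (A i)"
  shows "(\<Sum>g\<in>PiE {..<k} A. (\<Prod>i<k. w i (g i)) * vandermonde k (\<lambda>i. x (g i))) =
    det (mat k k (\<lambda>(i, l). \<Sum>s\<in>A i. w i s * x s ^ l))"
  using assms by (simp add: vandermonde_def det_mat_sum_rows det_mat_scale_rows)

text \<open>The recursion behind the 2-enumeration of Mills, Robbins and Rumsey. The determinant \<open>D\<close>
  applies the functionals \<open>p \<mapsto> \<Sum>s\<in>{t i..<t (Suc i)}. p s\<close> to the monomials; the weighted sum and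
  the Vandermonde determinant of \<open>T\<close> apply them to \<open>x ^ l + (x + 1) ^ l\<close> and to
  \<open>(x + 1) ^ Suc l - x ^ Suc l\<close>.\<close>

lemma sum_interlacing_difference_product:
  assumes T: "finite T" "card T = Suc k"
  shows "(\<Sum>S | finite S \<and> card S = k \<and> interlacing S T. 2 ^ card (S - T) * difference_product S) =
    2 ^ k / fact k * difference_product T"
proof -
  define t where "t = enum T"
  define w :: "nat \<Rightarrow> nat \<Rightarrow> rat" where "w i s = (if s = t i \<or> s = t (Suc i) then 1 else 2)" for i s
  define D where "D = det (mat k k (\<lambda>(i, l). \<Sum>s\<in>{t i..<t (Suc i)}. of_nat s ^ l :: rat))"
  have t_mono: "t i < t j" if "i < j" "j \<le> k" for i j
    unfolding t_def using enum_strict_mono[OF T(1) that(1)] that T by simp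
  have t_image: "t ` {..k} = T"
    using enum_image[OF T(1)] T by (simp add: t_def lessThan_Suc_atMost)
  have weights: "(\<Prod>i<k. w i (enum S i)) = 2 ^ card (S - T)"
    if S: "finite S" "card S = k" and box: "\<forall>i<k. t i \<le> enum S i \<and> enum S i \<le> t (Suc i)" for S
  proof -
    \<comment> \<open>The \<open>i\<close>-th element of \<open>S\<close> lies between consecutive
      elements of \<open>T\<close>, so it can be in \<open>T\<close> only as one of these end
      points. The weight 2 therefore marks exactly the elements of \<open>S - T\<close>.\<close>
    have mem: "enum S i \<in> T \<longleftrightarrow> enum S i = t i \<or> enum S i = t (Suc i)" if "i < k" for i
    proof
      assume "enum S i \<in> T"
      then obtain j where j: "j \<le> k" "enum S i = t j" using t_image by auto
      have "\<not> j < i" using t_mono[of j i] box that j by fastforce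
      moreover have "\<not> Suc i < j" using t_mono[of "Suc i" j] box that j by fastforce
      ultimately show "enum S i = t i \<or> enum S i = t (Suc i)"
        using j by (metis le_antisym not_less not_less_eq_eq)
    next
      assume "enum S i = t i \<or> enum S i = t (Suc i)"
      moreover have "t i \<in> T" "t (Suc i) \<in> T"
        using t_image that by (auto simp: image_iff)
      ultimately show "enum S i \<in> T" by auto
    qed
    have "(\<Prod>i<k. w i (enum S i)) = (\<Prod>i<k. if enum S i \<in> T then 1 else 2)"
      by (intro prod.cong) (auto simp: w_def mem)
    also have "\<dots> = (\<Prod>s\<in>enum S ` {..<k}. if s \<in> T then 1 else 2)"
      using enum_inj_on[OF S(1)] S by (subst prod.reindex) auto
    also have "enum S ` {..<k} = S" using enum_image[OF S(1)] S by simp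
    also have "(\<Prod>s\<in>S. if s \<in> T then 1 else 2 :: rat) = 2 ^ card (S - T)"
      using S by (simp add: prod.If_cases Diff_eq)
    finally show ?thesis .
  qed
  have "(\<Sum>S | finite S \<and> card S = k \<and> interlacing S T. 2 ^ card (S - T) * difference_product S) =
    (\<Sum>S | finite S \<and> card S = k \<and> (\<forall>i<k. t i \<le> enum S i \<and> enum S i \<le> t (Suc i)).
      (\<Prod>i<k. w i (enum S i)) * difference_product S)"
    using T by (intro sum.cong) (auto simp: interlacing_iff_enum t_def weights[unfolded t_def])
  also have "\<dots> = det (mat k k (\<lambda>(i, l). \<Sum>s\<in>{t i..t (Suc i)}. w i s * of_nat s ^ l))"
    by (subst sum_PiE_vandermonde[symmetric]) (simp_all add: sum_PiE_weighted_vandermonde)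
  also have "\<dots> = det (mat k k (\<lambda>(i, l). \<Sum>s\<in>{t i..<t (Suc i)}. of_nat s ^ l + (of_nat s + 1) ^ l))"
    by (intro arg_cong[where f = det] eq_matI)
      (auto simp: w_def sum_endpoint_weights t_mono add.commute)
  also have "\<dots> = 2 ^ k * D"
    unfolding D_def by (rule det_mat_sum_adjacent_powers)
  also have "D = difference_product T / fact k"
  proof -
    have "fact k * D = det (mat k k (\<lambda>(i, l). \<Sum>s\<in>{t i..<t (Suc i)}. (of_nat s + 1) ^ Suc l - of_nat s ^ Suc l))"
      unfolding D_def by (rule det_mat_sum_power_step[symmetric])
    also have "\<dots> = det (mat k k (\<lambda>(i, l). of_nat (t (Suc i)) ^ Suc l - of_nat (t i) ^ Suc l))"
    proof (intro arg_cong[where f = det] eq_matI)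
      fix i l assume "i < dim_row (mat k k (\<lambda>(i, l). of_nat (t (Suc i)) ^ Suc l - of_nat (t i) ^ Suc l :: rat))"
        "l < dim_col (mat k k (\<lambda>(i, l). of_nat (t (Suc i)) ^ Suc l - of_nat (t i) ^ Suc l :: rat))"
      then show "mat k k (\<lambda>(i, l). \<Sum>s\<in>{t i..<t (Suc i)}. (of_nat s + 1) ^ Suc l - of_nat s ^ Suc l) $$ (i, l) =
          mat k k (\<lambda>(i, l). of_nat (t (Suc i)) ^ Suc l - of_nat (t i) ^ Suc l :: rat) $$ (i, l)"
        using sum_Suc_diff'[of "t i" "t (Suc i)" "\<lambda>s. of_nat s ^ Suc l :: rat"] t_mono[of i "Suc i"]
        by (simp add: add.commute del: power_Suc)
    qed auto
    also have "\<dots> = vandermonde (Suc k) (\<lambda>i. of_nat (t i))"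
      by (rule det_mat_power_diff)
    also have "\<dots> = difference_product (t ` {..<Suc k})"
      by (rule difference_product_strict_mono[symmetric]) (auto intro!: strict_mono_onI t_mono)
    finally show ?thesis
      by (simp add: t_image lessThan_Suc_atMost field_simps)
  qed
  finally show ?thesis by simp
qed

text \<open>For finite sets of equal size: \<open>S\<close> arises from \<open>Y\<close> by moving
  the \<open>i\<close>-th element by 0 or 1, see \<open>half_step_iff_enum\<close>. The form with
  counts suits the later comparison of prefix counts.\<close>

definition half_step :: "nat set \<Rightarrow> nat set \<Rightarrow> bool" where
  "half_step Y S \<longleftrightarrow>
     (\<forall>j. card (Y \<inter> {..<j}) \<le> card (S \<inter> {..<Suc j}) \<and> card (S \<inter> {..<j}) \<le> card (Y \<inter> {..<j}))"

lemma half_step_iff_enum: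
  assumes S: "finite S" "card S = k" and Y: "finite Y" "card Y = k"
  shows "half_step Y S \<longleftrightarrow> (\<forall>i<k. enum Y i \<le> enum S i \<and> enum S i \<le> Suc (enum Y i))"
proof
  assume hs: "half_step Y S"
  show "\<forall>i<k. enum Y i \<le> enum S i \<and> enum S i \<le> Suc (enum Y i)"
  proof (intro allI impI conjI)
    fix i assume i: "i < k"
    have "i < card (S \<inter> {..<Suc (enum S i)})"
      using enum_less_iff[OF S(1), of i "Suc (enum S i)"] S i by simp
    also have "\<dots> \<le> card (Y \<inter> {..<Suc (enum S i)})"
      using hs by (simp add: half_step_def)
    finally show "enum Y i \<le> enum S i"
      using enum_less_iff[OF Y(1), of i "Suc (enum S i)"] Y i by simp
    have "i < card (Y \<inter> {..<Suc (enum Y i)})"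
      using enum_less_iff[OF Y(1), of i "Suc (enum Y i)"] Y i by simp
    also have "\<dots> \<le> card (S \<inter> {..<Suc (Suc (enum Y i))})"
      using hs by (simp add: half_step_def)
    finally show "enum S i \<le> Suc (enum Y i)"
      using enum_less_iff[OF S(1), of i "Suc (Suc (enum Y i))"] S i by simp
  qed
next
  assume hs: "\<forall>i<k. enum Y i \<le> enum S i \<and> enum S i \<le> Suc (enum Y i)"
  show "half_step Y S"
    unfolding half_step_def
  proof (intro allI conjI)
    fix j
    show "card (S \<inter> {..<j}) \<le> card (Y \<inter> {..<j})"
    proof (cases "card (S \<inter> {..<j})")
      case (Suc i)
      then have i: "i < k" using card_Int_lessThan_le[OF S(1), of j] S by simp
      then have "enum S i < j" using enum_less_iff[OF S(1), of i j] S Suc by simp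
      then have "enum Y i < j" using hs i by (meson le_less_trans)
      then show ?thesis using enum_less_iff[OF Y(1), of i j] Y i Suc by simp
    qed simp
    show "card (Y \<inter> {..<j}) \<le> card (S \<inter> {..<Suc j})"
    proof (cases "card (Y \<inter> {..<j})")
      case (Suc i)
      then have i: "i < k" using card_Int_lessThan_le[OF Y(1), of j] Y by simp
      then have "enum Y i < j" using enum_less_iff[OF Y(1), of i j] Y Suc by simp
      then have "enum S i < Suc j" using hs i by (meson Suc_less_eq le_less_trans)
      then show ?thesis using enum_less_iff[OF S(1), of i "Suc j"] S i Suc by simp
    qed simp
  qed
qed

text \<open>Consecutive intervals \<open>{y i..Suc (y i)}\<close> share at most an end point, so
  \<open>sum_PiE_vandermonde\<close> applies; summing over the two points of an interval replaces
  \<open>x ^ l\<close> by \<open>x ^ l + (x + 1) ^ l\<close>.\<close>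

lemma sum_half_step_difference_product:
  assumes Y: "finite Y" "card Y = k"
  shows "(\<Sum>S | finite S \<and> card S = k \<and> half_step Y S. difference_product S) = 2 ^ k * difference_product Y"
proof -
  define y where "y = enum Y"
  have y_mono: "y i < y j" if "i < j" "j < k" for i j
    unfolding y_def using enum_strict_mono[OF Y(1) that(1)] that Y by simp
  have "(\<Sum>S | finite S \<and> card S = k \<and> half_step Y S. difference_product S) =
    (\<Sum>S | finite S \<and> card S = k \<and> (\<forall>i<k. y i \<le> enum S i \<and> enum S i \<le> Suc (y i)).
      (\<Prod>i<k. 1) * difference_product S)"
    using Y by (intro sum.cong) (auto simp: half_step_iff_enum y_def)
  also have "\<dots> = det (mat k k (\<lambda>(i, l). \<Sum>s\<in>{y i..Suc (y i)}. 1 * of_nat s ^ l))"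
    by (subst sum_PiE_vandermonde[symmetric])
      (auto simp: Suc_le_eq y_mono sum_PiE_weighted_vandermonde[where w = "\<lambda>_ _. 1", simplified])
  also have "\<dots> = det (mat k k (\<lambda>(i, l). \<Sum>s\<in>{y i}. of_nat s ^ l + (of_nat s + 1) ^ l))"
    by (intro arg_cong[where f = det] eq_matI) (auto simp: atLeastAtMostSuc_conv add.commute)
  also have "\<dots> = 2 ^ k * vandermonde k (\<lambda>i. of_nat (y i))"
    by (simp only: det_mat_sum_adjacent_powers) (simp add: vandermonde_def)
  also have "vandermonde k (\<lambda>i. of_nat (y i)) = difference_product (y ` {..<k})"
    by (rule difference_product_strict_mono[symmetric]) (auto intro!: strict_mono_onI y_mono)
  also have "y ` {..<k} = Y"
    using enum_image[OF Y(1)] Y by (simp add: y_def)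
  finally show ?thesis .
qed

section \<open>Difference products over transversals\<close>

text \<open>For \<open>j < m\<close>, the common distance of \<open>m + j\<close> and
  \<open>m - 1 - j\<close> from the centre \<open>m - 1 / 2\<close> of
  \<open>{..<2 * m}\<close>.\<close>

definition centred :: "nat \<Rightarrow> rat" where
  "centred j = of_nat j + 1 / 2"

definition transversals :: "nat \<Rightarrow> nat set set" where
  "transversals m = {Y. Y \<subseteq> {..<2 * m} \<and> (\<forall>j<2 * m. j \<in> Y \<longleftrightarrow> 2 * m - 1 - j \<notin> Y)}"

lemma sum_transversals_eq_det:
  "(\<Sum>Y\<in>transversals m. difference_product Y) =
    det (mat m m (\<lambda>(j, l). \<Sum>e\<in>{1, -1}. e ^ j * (e * centred j) ^ l))"
proof -
  \<comment> \<open>\<open>pos j e\<close> is the point at distance \<open>centred j\<close> from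
    the centre, on the side given by the sign \<open>e\<close>.\<close>
  define pos :: "nat \<Rightarrow> rat \<Rightarrow> nat" where "pos j e = (if e = 1 then m + j else m - 1 - j)" for j e
  define E where "E = PiE {..<m} (\<lambda>_. {1, -1 :: rat})"
  have Emem: "g j = 1 \<or> g j = -1" if "g \<in> E" "j < m" for g j
    using that by (auto simp: E_def PiE_iff)
  have pos_less: "pos j e < 2 * m" if "j < m" for j e
    using that by (auto simp: pos_def)
  have pos_eq: "of_nat (pos j (g j)) = of_nat m - 1 / 2 + g j * centred j" if "g \<in> E" "j < m" for g j
    using Emem[OF that] that by (auto simp: pos_def centred_def of_nat_diff field_simps)
  have pos_inj: "i = j \<and> d = e" if "pos i d = pos j e" "i < m" "j < m" "d \<in> {1, -1}" "e \<in> {1, -1}" for i j d e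
    using that by (auto simp: pos_def split: if_splits)
  have inj: "inj_on (\<lambda>j. pos j (g j)) {..<m}" if "g \<in> E" for g
    using pos_inj Emem[OF that] by (auto intro!: inj_onI)
  have "(\<Sum>Y\<in>transversals m. difference_product Y) =
      (\<Sum>g\<in>E. difference_product ((\<lambda>j. pos j (g j)) ` {..<m}))"
  proof (rule sum.reindex_bij_witness[where
        i = "\<lambda>g. (\<lambda>j. pos j (g j)) ` {..<m}" and
        j = "\<lambda>Y. \<lambda>j\<in>{..<m}. if m + j \<in> Y then 1 else - 1"])
    fix Y assume Y: "Y \<in> transversals m"
    have sym: "m + j \<in> Y \<longleftrightarrow> m - 1 - j \<notin> Y" if "j < m" for j
    proof -
      have "m + j < 2 * m" "2 * m - 1 - (m + j) = m - 1 - j" using that by simp_all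
      moreover have "\<forall>j<2 * m. j \<in> Y \<longleftrightarrow> 2 * m - 1 - j \<notin> Y"
        using Y unfolding transversals_def by blast
      ultimately show ?thesis by (metis (full_types))
    qed
    show "(\<lambda>j\<in>{..<m}. if m + j \<in> Y then 1 else - 1) \<in> E"
      by (auto simp: E_def)
    show img: "(\<lambda>j. pos j ((\<lambda>j\<in>{..<m}. if m + j \<in> Y then 1 else - 1) j)) ` {..<m} = Y" (is "?I = Y")
    proof
      show "?I \<subseteq> Y" using sym by (auto simp: pos_def)
      show "Y \<subseteq> ?I"
      proof
        fix y assume y: "y \<in> Y"
        then have "y < 2 * m" using Y by (auto simp: transversals_def)
        show "y \<in> ?I"
        proof (cases "y < m")
          case True
          then show ?thesis using y sym[of "m - 1 - y"]
            by (intro image_eqI[of _ _ "m - 1 - y"]) (auto simp: pos_def)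
        next
          case False
          then show ?thesis using y \<open>y < 2 * m\<close>
            by (intro image_eqI[of _ _ "y - m"]) (auto simp: pos_def)
        qed
      qed
    qed
    then show "difference_product ?I = difference_product Y" by simp
  next
    fix g assume g: "g \<in> E"
    let ?I = "(\<lambda>j. pos j (g j)) ` {..<m}"
    have mem: "pos j e \<in> ?I \<longleftrightarrow> g j = e" if "j < m" "e \<in> {1, -1}" for j e
    proof
      assume "pos j e \<in> ?I"
      then obtain i where "i < m" "pos j e = pos i (g i)" by auto
      then show "g j = e" using pos_inj[of j e i "g i"] Emem[OF g, of i] that by auto
    qed (use that in blast)
    show "(\<lambda>j\<in>{..<m}. if m + j \<in> ?I then 1 else - 1) = g"
    proof
      fix j
      show "(\<lambda>j\<in>{..<m}. if m + j \<in> ?I then 1 else - 1) j = g j"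
        using mem[of j 1] Emem[OF g, of j] g by (auto simp: pos_def E_def PiE_iff extensional_def)
    qed
    show "?I \<in> transversals m"
      unfolding transversals_def
    proof (intro CollectI conjI allI impI)
      show "?I \<subseteq> {..<2 * m}" using pos_less by auto
      fix y assume y: "y < 2 * m"
      have P: "m + j \<in> ?I \<longleftrightarrow> m - 1 - j \<notin> ?I" if "j < m" for j
        using mem[OF that, of 1] mem[OF that, of "-1"] Emem[OF g that] by (auto simp: pos_def)
      show "y \<in> ?I \<longleftrightarrow> 2 * m - 1 - y \<notin> ?I"
      proof (cases "y < m")
        case True
        then have "m + (m - 1 - y) = 2 * m - 1 - y" "m - 1 - (m - 1 - y) = y" by auto
        then show ?thesis using P[of "m - 1 - y"] True by auto
      next
        case False
        then have "m + (y - m) = y" "m - 1 - (y - m) = 2 * m - 1 - y" by auto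
        then show ?thesis using P[of "y - m"] False y by auto
      qed
    qed
  qed
  also have "\<dots> = (\<Sum>g\<in>E. (\<Prod>j<m. g j ^ j) * vandermonde m (\<lambda>j. g j * centred j))"
  proof (rule sum.cong)
    fix g assume g: "g \<in> E"
    have "difference_product ((\<lambda>j. pos j (g j)) ` {..<m}) =
        (\<Prod>j<m. \<Prod>i<j. \<bar>of_nat (pos j (g j)) - of_nat (pos i (g i))\<bar>)"
      by (rule difference_product_image[OF inj[OF g]])
    \<comment> \<open>Since \<open>centred i < centred j\<close>, the sign of the difference is that
      of its first term, \<open>g j\<close>. Row \<open>j\<close> collects this sign once for each
      \<open>i < j\<close>, hence the factor \<open>g j ^ j\<close>.\<close>
    also have "\<dots> = (\<Prod>j<m. \<Prod>i<j. g j * (g j * centred j - g i * centred i))"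
    proof (intro prod.cong refl)
      fix i j assume "j \<in> {..<m}" "i \<in> {..<j}"
      then have ij: "i < m" "j < m" "i < j" by auto
      then have "centred i < centred j" "0 < centred i" by (auto simp: centred_def)
      then show "\<bar>of_nat (pos j (g j)) - of_nat (pos i (g i))\<bar> = g j * (g j * centred j - g i * centred i)"
        using Emem[OF g ij(1)] Emem[OF g ij(2)] ij by (auto simp: pos_eq[OF g])
    qed
    also have "\<dots> = (\<Prod>j<m. g j ^ j) * vandermonde m (\<lambda>j. g j * centred j)"
      by (simp add: vandermonde_eq_prod prod.distrib)
    finally show "difference_product ((\<lambda>j. pos j (g j)) ` {..<m}) = \<dots>" .
  qed simp
  also have "\<dots> = (\<Sum>g\<in>E. det (mat m m (\<lambda>(j, l). g j ^ j * (g j * centred j) ^ l)))"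
    by (simp add: vandermonde_def det_mat_scale_rows)
  also have "\<dots> = det (mat m m (\<lambda>(j, l). \<Sum>e\<in>{1, -1}. e ^ j * (e * centred j) ^ l))"
    unfolding E_def by (subst det_mat_sum_rows) auto
  finally show ?thesis .
qed

text \<open>Replacing the monomials \<open>x ^ l\<close> by these polynomials, which keep the parity of \<open>l\<close>, makes
  the matrix of \<open>sum_transversals_eq_det\<close> triangular.\<close>

definition parity_poly :: "nat \<Rightarrow> rat poly" where
  "parity_poly l = monom 1 (l mod 2) * (\<Prod>i\<in>{i. i < l \<and> even (l + i)}. [:- (centred i ^ 2), 0, 1:])"

text \<open>Counts the quadratic factors of \<open>parity_poly l\<close>; with the monomial of
  exponent \<open>l mod 2\<close> they give degree \<open>l\<close>.\<close>

lemma card_same_parity: "2 * card {i. i < l \<and> even (l + i)} + l mod 2 = l"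
proof (induction l rule: nat_less_induct)
  case (1 l)
  consider "l = 0" | "l = 1" | k where "l = Suc (Suc k)"
    by (cases l) (auto simp: not0_implies_Suc, metis not0_implies_Suc)
  then show ?case
  proof cases
    case 3
    then have "{i. i < l \<and> even (l + i)} = insert k {i. i < k \<and> even (k + i)}"
      by (auto simp: less_Suc_eq)
    then show ?thesis using 1[rule_format, of k] 3 by simp
  qed (auto simp: card_eq_0_iff intro!: odd_pos)
qed

lemma parity_poly_degree: "degree (parity_poly l) = l"
  and parity_poly_lead_coeff: "lead_coeff (parity_poly l) = 1"
proof -
  let ?P = "\<Prod>i\<in>{i. i < l \<and> even (l + i)}. [:- (centred i ^ 2), 0, 1:]"
  have "degree ?P = 2 * card {i. i < l \<and> even (l + i)}"
    by (subst degree_prod_eq_sum_degree) auto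
  moreover have "lead_coeff ?P = 1" by (simp add: lead_coeff_prod)
  moreover from this have "?P \<noteq> 0" by (metis leading_coeff_0_iff zero_neq_one)
  ultimately show "degree (parity_poly l) = l"
    unfolding parity_poly_def using card_same_parity[of l]
    by (simp add: degree_mult_eq degree_monom_eq monom_eq_0_iff)
  have "lead_coeff (monom (1 :: rat) (l mod 2)) = 1"
    by (simp add: degree_monom_eq)
  with \<open>lead_coeff ?P = 1\<close> show "lead_coeff (parity_poly l) = 1"
    unfolding parity_poly_def lead_coeff_mult by simp
qed

lemma poly_parity_poly:
  "poly (parity_poly l) x = x ^ (l mod 2) * (\<Prod>i\<in>{i. i < l \<and> even (l + i)}. x ^ 2 - centred i ^ 2)"
  by (simp add: parity_poly_def poly_prod poly_monom power2_eq_square)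

lemma poly_parity_poly_signed:
  assumes "e \<in> {1, -1}"
  shows "poly (parity_poly l) (e * x) = e ^ l * poly (parity_poly l) x"
proof -
  have "e ^ (l mod 2) = e ^ l"
    using assms by (cases "even l") (auto simp: odd_iff_mod_2_eq_one even_iff_mod_2_eq_zero)
  moreover have "e ^ 2 = 1" using assms by auto
  ultimately show ?thesis by (simp add: poly_parity_poly power_mult_distrib)
qed

text \<open>After the change of columns the entry is \<open>1 + (-1) ^ (j + l)\<close> times
  \<open>poly (parity_poly l) (centred j)\<close>. It vanishes for odd \<open>j + l\<close>, and for
  even \<open>j + l\<close> with \<open>j < l\<close> because \<open>centred j\<close> is a root.
  The matrix is thus triangular.\<close>

lemma sum_transversals:
  "(\<Sum>Y\<in>transversals m. difference_product Y) = (\<Prod>j<m. 2 * poly (parity_poly j) (centred j))"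
proof -
  have poly_sum: "poly (parity_poly l) y = (\<Sum>k<m. coeff (parity_poly l) k * y ^ k)" if "l < m" for l y
    using that by (intro poly_eq_sum_lessThan) (simp add: parity_poly_degree)
  have "mat m m (\<lambda>(j, l). \<Sum>k<m. coeff (parity_poly l) k * (\<Sum>e\<in>{1, -1}. e ^ j * (e * centred j) ^ k)) =
      mat m m (\<lambda>(j, l). \<Sum>e\<in>{1, -1}. e ^ j * poly (parity_poly l) (e * centred j))"
    by (intro eq_matI)
      (auto simp: poly_sum sum_distrib_left sum.distrib distrib_left mult_ac)
  moreover have "det \<dots> = (\<Prod>j<m. 2 * poly (parity_poly j) (centred j))"
  proof -
    let ?M = "mat m m (\<lambda>(j, l). \<Sum>e\<in>{1, -1}. e ^ j * poly (parity_poly l) (e * centred j))"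
    have ent: "?M $$ (j, l) = (if even (l + j) then 2 * poly (parity_poly l) (centred j) else 0)"
      if "j < m" "l < m" for j l
    proof -
      have "?M $$ (j, l) = (1 + (-1) ^ (j + l)) * poly (parity_poly l) (centred j)"
        using that poly_parity_poly_signed[of "-1" l "centred j"]
        by (simp add: power_add distrib_right)
      then show ?thesis by (simp add: add.commute)
    qed
    have "det ?M = prod_list (diag_mat ?M)"
    proof (rule det_lower_triangular[of m])
      fix j l assume "j < l" "l < m"
      then have "even (l + j) \<Longrightarrow> (\<Prod>i\<in>{i. i < l \<and> even (l + i)}. centred j ^ 2 - centred i ^ 2) = 0"
        by (intro prod_zero) auto
      then have "even (l + j) \<Longrightarrow> poly (parity_poly l) (centred j) = 0"
        by (simp add: poly_parity_poly)
      then show "?M $$ (j, l) = 0" using \<open>j < l\<close> \<open>l < m\<close> by (subst ent) auto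
    qed simp
    also have "\<dots> = (\<Prod>j<m. ?M $$ (j, j))"
      by (simp add: prod_list_diag_prod atLeast0LessThan)
    also have "\<dots> = (\<Prod>j<m. 2 * poly (parity_poly j) (centred j))"
      by (intro prod.cong refl, subst ent) auto
    finally show ?thesis .
  qed
  ultimately show ?thesis
    using det_mat_polynomial_columns[where m = m and Q = parity_poly and
        f = "\<lambda>j k. \<Sum>e\<in>{1, -1}. e ^ j * (e * centred j) ^ k"]
      parity_poly_lead_coeff
    by (simp add: sum_transversals_eq_det parity_poly_degree)
qed

section \<open>The top rows of an alternating sign matrix\<close>

text \<open>An invariant strong enough for induction: a segment sum is 0 or the last nonzero entry
  of the segment, and the next nonzero entry has the opposite sign.\<close>

lemma alternating_segment_sum:
  fixes v :: "int vec"
  assumes alt: "alternating_signs v"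
    and ent: "\<And>j. j < dim_vec v \<Longrightarrow> v $ j \<in> {1, -1, 0}"
    and "a \<le> b" "b \<le> dim_vec v"
  shows "(\<Sum>l\<in>{a..<b}. v $ l) = 0 \<and> (\<forall>l\<in>{a..<b}. v $ l = 0) \<or>
    (\<exists>l\<in>{a..<b}. v $ l \<noteq> 0 \<and> (\<forall>l'. l < l' \<and> l' < b \<longrightarrow> v $ l' = 0) \<and>
      (\<Sum>l\<in>{a..<b}. v $ l) \<in> {0, v $ l})"
  using assms(3,4)
proof (induction b rule: dec_induct)
  case (step b)
  let ?s = "\<lambda>b. \<Sum>l\<in>{a..<b}. v $ l"
  have s: "?s (Suc b) = ?s b + v $ b" using step by simp
  show ?case
  proof (cases "v $ b = 0")
    case True
    from step have "?s b = 0 \<and> (\<forall>l\<in>{a..<b}. v $ l = 0) \<or>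
      (\<exists>l\<in>{a..<b}. v $ l \<noteq> 0 \<and> (\<forall>l'. l < l' \<and> l' < b \<longrightarrow> v $ l' = 0) \<and> ?s b \<in> {0, v $ l})" by simp
    then show ?thesis
    proof (elim disjE conjE bexE)
      fix l assume l: "l \<in> {a..<b}" "v $ l \<noteq> 0" "\<forall>l'. l < l' \<and> l' < b \<longrightarrow> v $ l' = 0" "?s b \<in> {0, v $ l}"
      show ?thesis
        using l True s by (intro disjI2 bexI[of _ l]) (auto simp: less_Suc_eq)
    qed (use True s in \<open>auto simp: less_Suc_eq\<close>)
  next
    case False
    from step have "?s b = 0 \<or>
      (\<exists>l\<in>{a..<b}. v $ l \<noteq> 0 \<and> (\<forall>l'. l < l' \<and> l' < b \<longrightarrow> v $ l' = 0) \<and> ?s b \<in> {0, v $ l})" by auto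
    then have "?s b \<in> {0, - (v $ b)}"
    proof (elim disjE bexE conjE)
      fix l assume l: "l \<in> {a..<b}" "v $ l \<noteq> 0" "\<forall>l'. l < l' \<and> l' < b \<longrightarrow> v $ l' = 0" "?s b \<in> {0, v $ l}"
      have "sgn (v $ b) = - sgn (v $ l)"
        using alt l False step.prems unfolding alternating_signs_def
        by (meson Suc_le_eq atLeastLessThan_iff)
      moreover have "v $ l \<in> {1, -1, 0}" "v $ b \<in> {1, -1, 0}"
        using ent step.prems l(1) by auto
      ultimately show ?thesis using l(4) by auto
    qed simp
    then show ?thesis
      using s False step by (intro disjI2 bexI[of _ b]) auto
  qed
qed simp

lemma alternating_signs_iff_prefix_sums:
  fixes v :: "int vec"
  assumes "(\<Sum>j<dim_vec v. v $ j) = 1"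
  shows "(\<forall>j<dim_vec v. v $ j \<in> {1, -1, 0}) \<and> alternating_signs v \<longleftrightarrow>
    (\<forall>k\<le>dim_vec v. (\<Sum>j<k. v $ j) \<in> {0, 1})"
proof
  assume v: "(\<forall>j<dim_vec v. v $ j \<in> {1, -1, 0}) \<and> alternating_signs v"
  show "\<forall>k\<le>dim_vec v. (\<Sum>j<k. v $ j) \<in> {0, 1}"
  proof (intro allI impI)
    fix k assume k: "k \<le> dim_vec v"
    have seg: "(\<Sum>l\<in>{a..<b}. v $ l) \<in> {1, -1, 0}" if "a \<le> b" "b \<le> dim_vec v" for a b
    proof -
      have "(\<Sum>l\<in>{a..<b}. v $ l) = 0 \<or> (\<exists>l\<in>{a..<b}. (\<Sum>l\<in>{a..<b}. v $ l) \<in> {0, v $ l})"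
        using alternating_segment_sum[OF conjunct2[OF v] _ that] v by blast
      moreover have "v $ l \<in> {1, -1, 0}" if "l \<in> {a..<b}" for l
        using v that \<open>b \<le> dim_vec v\<close> by simp
      ultimately show ?thesis by (metis (no_types, lifting) empty_iff insert_iff)
    qed
    \<comment> \<open>Prefix and complementary suffix have sums in \<open>{1, -1, 0}\<close> that
      add up to 1, which excludes the prefix sum -1.\<close>
    have "(\<Sum>j<k. v $ j) + (\<Sum>j\<in>{k..<dim_vec v}. v $ j) = 1"
      using sum.atLeastLessThan_concat[of 0 k "dim_vec v" "($) v"] k assms
      by (simp add: atLeast0LessThan)
    then show "(\<Sum>j<k. v $ j) \<in> {0, 1}"
      using seg[of 0 k] seg[of k "dim_vec v"] k by (auto simp: atLeast0LessThan)
  qed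
next
  assume v: "\<forall>k\<le>dim_vec v. (\<Sum>j<k. v $ j) \<in> {0, 1}"
  have ent: "v $ j = (\<Sum>l<Suc j. v $ l) - (\<Sum>l<j. v $ l)" for j
    by simp
  have "v $ j \<in> {1, -1, 0}" if "j < dim_vec v" for j
    unfolding ent[of j] using v[rule_format, of j] v[rule_format, of "Suc j"] that by (auto simp del: sum.lessThan_Suc)
  moreover have "sgn (v $ k) = - sgn (v $ j)"
    if "j < k" "k < dim_vec v" "v $ j \<noteq> 0" "v $ k \<noteq> 0" "\<forall>l. j < l \<and> l < k \<longrightarrow> v $ l = 0" for j k
  proof -
    \<comment> \<open>The prefix sum does not change between two neighbouring nonzero entries, so
      the second has to undo the first.\<close>
    have "(\<Sum>l<k. v $ l) = (\<Sum>l<Suc j. v $ l)"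
      using that by (intro sum.mono_neutral_right) auto
    then show ?thesis
      using ent[of j] ent[of k] v[rule_format, of j] v[rule_format, of "Suc j"] v[rule_format, of "Suc k"] that
      by (auto simp del: sum.lessThan_Suc)
  qed
  ultimately show "(\<forall>j<dim_vec v. v $ j \<in> {1, -1, 0}) \<and> alternating_signs v"
    unfolding alternating_signs_def by blast
qed

lemma alternating_sign_matrix_iff_prefix_sums:
  "alternating_sign_matrix n A \<longleftrightarrow> A \<in> carrier_mat n n \<and>
    (\<forall>i<n. (\<Sum>j<n. A $$ (i, j)) = 1) \<and> (\<forall>j<n. (\<Sum>i<n. A $$ (i, j)) = 1) \<and>
    (\<forall>i<n. \<forall>k\<le>n. (\<Sum>j<k. A $$ (i, j)) \<in> {0, 1}) \<and>
    (\<forall>j<n. \<forall>k\<le>n. (\<Sum>i<k. A $$ (i, j)) \<in> {0, 1})"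
proof (cases "A \<in> carrier_mat n n \<and>
    (\<forall>i<n. (\<Sum>j<n. A $$ (i, j)) = 1) \<and> (\<forall>j<n. (\<Sum>i<n. A $$ (i, j)) = 1)")
  case True
  then have A: "dim_row A = n" "dim_col A = n" and sums: "\<And>i. i < n \<Longrightarrow> (\<Sum>j<n. A $$ (i, j)) = 1"
    "\<And>j. j < n \<Longrightarrow> (\<Sum>i<n. A $$ (i, j)) = 1" by auto
  have line: "(\<forall>j<n. f j \<in> {1, -1, 0}) \<and> alternating_signs v \<longleftrightarrow> (\<forall>k\<le>n. (\<Sum>j<k. f j) \<in> {0, 1})"
    if "dim_vec v = n" "\<And>j. j < n \<Longrightarrow> v $ j = f j" "(\<Sum>j<n. f j) = 1" for v :: "int vec" and f
  proof -
    have *: "(\<Sum>j<k. v $ j) = (\<Sum>j<k. f j)" if "k \<le> n" for k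
      using that \<open>\<And>j. j < n \<Longrightarrow> v $ j = f j\<close> by (intro sum.cong) auto
    have "(\<forall>j<n. v $ j \<in> {1, -1, 0}) \<longleftrightarrow> (\<forall>j<n. f j \<in> {1, -1, 0})"
      using that(2) by simp
    moreover have "(\<forall>k\<le>n. (\<Sum>j<k. v $ j) \<in> {0, 1}) \<longleftrightarrow> (\<forall>k\<le>n. (\<Sum>j<k. f j) \<in> {0, 1})"
      using * by simp
    moreover have total: "(\<Sum>j<dim_vec v. v $ j) = 1"
      using *[of n] that(1,3) by simp
    ultimately show ?thesis
      using alternating_signs_iff_prefix_sums[OF total, unfolded that(1)] by argo
  qed
  have row: "(\<forall>j<n. A $$ (i, j) \<in> {1, -1, 0}) \<and> alternating_signs (row A i) \<longleftrightarrow>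
      (\<forall>k\<le>n. (\<Sum>j<k. A $$ (i, j)) \<in> {0, 1})" if "i < n" for i
    using A that sums by (intro line) auto
  have col: "(\<forall>i<n. A $$ (i, j) \<in> {1, -1, 0}) \<and> alternating_signs (col A j) \<longleftrightarrow>
      (\<forall>k\<le>n. (\<Sum>i<k. A $$ (i, j)) \<in> {0, 1})" if "j < n" for j
    using A that sums by (intro line) auto
  have "alternating_sign_matrix n A \<longleftrightarrow>
      (\<forall>i<n. (\<forall>j<n. A $$ (i, j) \<in> {1, -1, 0}) \<and> alternating_signs (row A i)) \<and>
      (\<forall>j<n. (\<forall>i<n. A $$ (i, j) \<in> {1, -1, 0}) \<and> alternating_signs (col A j))"
  proof -
    have "C \<and> (\<forall>i<n. \<forall>j<n. e i j) \<and> R \<and> K \<and> (\<forall>i<n. r i) \<and> (\<forall>j<n. c j) \<longleftrightarrow>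
        (\<forall>i<n. (\<forall>j<n. e i j) \<and> r i) \<and> (\<forall>j<n. (\<forall>i<n. e i j) \<and> c j)"
      if "C \<and> R \<and> K" for C R K :: bool and e :: "nat \<Rightarrow> nat \<Rightarrow> bool" and r c
      using that by blast
    from this[OF True] show ?thesis unfolding alternating_sign_matrix_def .
  qed
  also have "\<dots> \<longleftrightarrow> (\<forall>i<n. \<forall>k\<le>n. (\<Sum>j<k. A $$ (i, j)) \<in> {0, 1}) \<and>
      (\<forall>j<n. \<forall>k\<le>n. (\<Sum>i<k. A $$ (i, j)) \<in> {0, 1})"
    using row col by (intro arg_cong2[where f = "(\<and>)"] all_cong1 imp_cong refl) blast+
  finally show ?thesis using True by argo
qed (auto simp: alternating_sign_matrix_def)

text \<open>The possible first \<open>k\<close> rows of an alternating sign matrix with \<open>N\<close> columns whose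
  partial column sums after these rows are the indicator function of \<open>T\<close>.\<close>

definition top_rows :: "nat \<Rightarrow> nat \<Rightarrow> nat set \<Rightarrow> (nat \<Rightarrow> nat \<Rightarrow> int) set" where
  "top_rows N k T = {a.
     (\<forall>i j. a i j \<noteq> 0 \<longrightarrow> i < k \<and> j < N) \<and>
     (\<forall>i<k. (\<Sum>j<N. a i j) = 1) \<and>
     (\<forall>i<k. \<forall>l\<le>N. (\<Sum>j<l. a i j) \<in> {0, 1}) \<and>
     (\<forall>j<N. \<forall>l\<le>k. (\<Sum>i<l. a i j) \<in> {0, 1}) \<and>
     (\<forall>j<N. (\<Sum>i<k. a i j) = of_bool (j \<in> T))}"

section \<open>Weighted enumeration of the top rows\<close>

definition negatives :: "(nat \<Rightarrow> nat \<Rightarrow> int) \<Rightarrow> (nat \<times> nat) set" where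
  "negatives a = {(i, j). a i j = -1}"

definition weight :: "nat \<Rightarrow> nat \<Rightarrow> nat set \<Rightarrow> rat" where
  "weight N k T = (\<Sum>a\<in>top_rows N k T. 2 ^ card (negatives a))"

lemma top_rows_0: "T \<subseteq> {..<N} \<Longrightarrow> top_rows N 0 T = (if T = {} then {\<lambda>_ _. 0} else {})"
  by (auto simp: top_rows_def fun_eq_iff)

text \<open>The row that turns the partial column sums from the indicator function of
  \<open>S\<close> into that of \<open>T\<close>. Its entries -1 are at \<open>S - T\<close>, the
  source of the weights \<open>2 ^ card (S - T)\<close>.\<close>

definition next_row :: "nat set \<Rightarrow> nat set \<Rightarrow> nat \<Rightarrow> int" where
  "next_row S T j = of_bool (j \<in> T) - of_bool (j \<in> S)"

lemma sum_next_row: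
  assumes "finite S" "finite T"
  shows "(\<Sum>j<l. next_row S T j) = int (card (T \<inter> {..<l})) - int (card (S \<inter> {..<l}))"
proof -
  have "(\<Sum>j<l. of_bool (j \<in> T) :: int) = int (card (T \<inter> {..<l}))" for T
    by (simp add: sum.If_cases of_bool_def Int_commute)
  then show ?thesis by (simp add: next_row_def sum_subtractf)
qed

lemma interlacing_iff_next_row:
  assumes S: "S \<subseteq> {..<N}" and T: "T \<subseteq> {..<N}"
  shows "interlacing S T \<longleftrightarrow> (\<forall>l\<le>N. (\<Sum>j<l. next_row S T j) \<in> {0, 1})"
proof -
  have fin: "finite S" "finite T" using S T finite_subset by blast+
  have *: "(\<Sum>j<l. next_row S T j) \<in> {0, 1} \<longleftrightarrow> card (S \<inter> {..<l}) \<le> card (T \<inter> {..<l}) \<and>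
      card (T \<inter> {..<l}) \<le> Suc (card (S \<inter> {..<l}))" for l
    using sum_next_row[OF fin, of l] by auto
  \<comment> \<open>Both counts are constant from \<open>N\<close> on, so the bound
    \<open>l \<le> N\<close> loses nothing.\<close>
  have "S \<inter> {..<l} = S \<inter> {..<min l N}" "T \<inter> {..<l} = T \<inter> {..<min l N}" for l
    using S T by auto
  then have "interlacing S T \<longleftrightarrow> (\<forall>l. (\<Sum>j<min l N. next_row S T j) \<in> {0, 1})"
    unfolding interlacing_def * by metis
  then show ?thesis by (metis min.cobounded2 min.absorb1)
qed

lemma card_top_rows:
  assumes "a \<in> top_rows N k T" "T \<subseteq> {..<N}"
  shows "card T = k"
proof -
  have "int (card T) = (\<Sum>j<N. of_bool (j \<in> T))"
    using assms(2) by (simp add: sum.If_cases of_bool_def Int_absorb1)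
  also have "\<dots> = (\<Sum>j<N. \<Sum>i<k. a i j)"
    using assms(1) by (simp add: top_rows_def)
  also have "\<dots> = (\<Sum>i<k. \<Sum>j<N. a i j)"
    by (rule sum.swap)
  also have "\<dots> = int k"
    using assms(1) by (simp add: top_rows_def)
  finally show ?thesis by simp
qed

definition column_set :: "nat \<Rightarrow> nat \<Rightarrow> (nat \<Rightarrow> nat \<Rightarrow> int) \<Rightarrow> nat set" where
  "column_set N k a = {j. j < N \<and> (\<Sum>i<k. a i j) = 1}"

text \<open>Appending a row and cutting off the last one (\<open>top_rows_Suc_restrict\<close>) are
  inverse to each other; together they give the bijection behind \<open>weight_Suc\<close>.\<close>

lemma top_rows_Suc_extend:
  assumes b: "b \<in> top_rows N k S" and S: "S \<subseteq> {..<N}" and T: "T \<subseteq> {..<N}" "card T = Suc k"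
    and il: "interlacing S T"
  shows "b(k := next_row S T) \<in> top_rows N (Suc k) T"
    and "column_set N k (b(k := next_row S T)) = S"
    and "(b(k := next_row S T))(k := \<lambda>_. 0) = b"
    and "card (negatives (b(k := next_row S T))) = card (S - T) + card (negatives b)"
proof -
  let ?a = "b(k := next_row S T)"
  have fin: "finite S" "finite T" using S T finite_subset by blast+
  have bk: "b k j = 0" for j using b by (auto simp: top_rows_def)
  have pre: "(\<Sum>i<l. ?a i j) = (\<Sum>i<l. b i j)" if "l \<le> k" for l j
    using that by (intro sum.cong) auto
  have tot: "(\<Sum>j<N. next_row S T j) = 1"
    using sum_next_row[OF fin, of N] card_top_rows[OF b S] T S by (simp add: Int_absorb2)
  have cols: "(\<Sum>i<k. b i j) = of_bool (j \<in> S)" if "j < N" for j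
    using b that by (simp add: top_rows_def)
  have sums: "(\<Sum>i<Suc k. ?a i j) = of_bool (j \<in> T)" if "j < N" for j
    using cols[OF that] pre[of k j] by (simp add: next_row_def)
  have supp: "i < k \<and> j < N" if "b i j \<noteq> 0" for i j
    using b that unfolding top_rows_def by blast
  have rows: "(\<Sum>j<N. b i j) = 1" "l \<le> N \<Longrightarrow> (\<Sum>j<l. b i j) \<in> {0, 1}" if "i < k" for i l
    using b that unfolding top_rows_def by blast+
  have b_cols: "(\<Sum>i<l. b i j) \<in> {0, 1}" if "j < N" "l \<le> k" for j l
    using b that unfolding top_rows_def by blast
  have next_cols: "(\<Sum>j<l. next_row S T j) \<in> {0, 1}" if "l \<le> N" for l
    using il that unfolding interlacing_iff_next_row[OF S T(1)] by blast
  show "?a \<in> top_rows N (Suc k) T"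
    unfolding top_rows_def
  proof (intro CollectI conjI allI impI)
    fix i j assume nz: "?a i j \<noteq> 0"
    have "i < Suc k \<and> j < N"
    proof (cases "i = k")
      case True
      then have "j \<in> S \<union> T" using nz by (auto simp: next_row_def of_bool_def split: if_splits)
      then show ?thesis using True S T by auto
    next
      case False
      then show ?thesis using supp[of i j] nz by simp
    qed
    then show "i < Suc k" "j < N" by blast+
  next
    fix i assume i: "i < Suc k"
    show "(\<Sum>j<N. ?a i j) = 1"
      using rows(1)[of i] tot i by (cases "i = k") simp_all
    fix l assume "l \<le> N"
    then show "(\<Sum>j<l. ?a i j) \<in> {0, 1}"
      using rows(2)[of i l] next_cols[of l] i by (cases "i = k") simp_all
  next
    fix j l assume jl: "j < N" "l \<le> Suc k"
    show "(\<Sum>i<l. ?a i j) \<in> {0, 1}"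
    proof (cases "l = Suc k")
      case True
      then show ?thesis using sums[OF jl(1)] by (simp only:) simp
    next
      case False
      then show ?thesis using pre[of l j] b_cols[of j l] jl by simp
    qed
  qed (rule sums)
  show "column_set N k ?a = S"
    using S by (auto simp: column_set_def pre cols)
  show "?a(k := \<lambda>_. 0) = b"
    using bk by (auto simp: fun_eq_iff)
  have "negatives ?a = (\<lambda>j. (k, j)) ` (S - T) \<union> negatives b"
    using bk by (auto simp: negatives_def next_row_def image_iff of_bool_def split: if_splits)
  moreover have "(\<lambda>j. (k, j)) ` (S - T) \<inter> negatives b = {}"
    using bk by (auto simp: negatives_def)
  moreover have "finite (negatives b)"
  proof (rule finite_subset)
    have "i < k \<and> j < N" if "b i j = -1" for i j
      using supp[of i j] that by simp
    then show "negatives b \<subseteq> {..<k} \<times> {..<N}" by (auto simp: negatives_def)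
  qed simp
  ultimately show "card (negatives ?a) = card (S - T) + card (negatives b)"
    using fin by (simp add: card_Un_disjoint card_image inj_on_def)
qed

lemma top_rows_Suc_restrict:
  assumes a: "a \<in> top_rows N (Suc k) T" and T: "T \<subseteq> {..<N}"
  defines "S \<equiv> column_set N k a" and "b \<equiv> a(k := \<lambda>_. 0)"
  shows "S \<subseteq> {..<N}" "b \<in> top_rows N k S" "card S = k" "interlacing S T" "b(k := next_row S T) = a"
proof -
  have supp: "i < Suc k \<and> j < N" if "a i j \<noteq> 0" for i j
    using a that unfolding top_rows_def by blast
  have rows: "(\<Sum>j<N. a i j) = 1" "l \<le> N \<Longrightarrow> (\<Sum>j<l. a i j) \<in> {0, 1}" if "i < Suc k" for i l
    using a that unfolding top_rows_def by blast+
  have a_cols: "(\<Sum>i<l. a i j) \<in> {0, 1}" if "j < N" "l \<le> Suc k" for j l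
    using a that unfolding top_rows_def by blast
  show S: "S \<subseteq> {..<N}" by (auto simp: S_def column_set_def)
  have pre: "(\<Sum>i<l. b i j) = (\<Sum>i<l. a i j)" if "l \<le> k" for l j
    using that by (intro sum.cong) (auto simp: b_def)
  have cols: "(\<Sum>i<k. a i j) = of_bool (j \<in> S)" if "j < N" for j
  proof -
    have "(\<Sum>i<k. a i j) \<in> {0, 1}" using a_cols[OF that] by simp
    then show ?thesis using that by (auto simp: S_def column_set_def)
  qed
  have ak: "a k j = next_row S T j" for j
  proof (cases "j < N")
    case True
    then have "(\<Sum>i<Suc k. a i j) = of_bool (j \<in> T)" using a unfolding top_rows_def by blast
    then show ?thesis using cols[OF True] by (simp add: next_row_def)
  next
    case False
    then have "a k j = 0" using a unfolding top_rows_def by blast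
    then show ?thesis using False S T by (auto simp: next_row_def)
  qed
  show "b \<in> top_rows N k S"
    unfolding top_rows_def
  proof (intro CollectI conjI allI impI)
    fix i j assume "b i j \<noteq> 0"
    then have "i \<noteq> k" "a i j \<noteq> 0" by (auto simp: b_def split: if_splits)
    then show "i < k" "j < N" using supp[of i j] by auto
  next
    fix i assume i: "i < k"
    then have "b i = a i" by (simp add: b_def)
    then show "(\<Sum>j<N. b i j) = 1" using rows(1)[of i] i by simp
    fix l assume "l \<le> N"
    then show "(\<Sum>j<l. b i j) \<in> {0, 1}" using rows(2)[of i l] \<open>b i = a i\<close> i by simp
  next
    fix j l assume "j < N" "l \<le> k"
    then show "(\<Sum>i<l. b i j) \<in> {0, 1}" using a_cols[of j l] pre[of l j] by simp
  next
    fix j assume "j < N"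
    then show "(\<Sum>i<k. b i j) = of_bool (j \<in> S)" using cols pre[of k j] by simp
  qed
  then show "card S = k" using card_top_rows S by blast
  show "interlacing S T"
    using rows(2)[of k] unfolding interlacing_iff_next_row[OF S T] ak by simp
  show "b(k := next_row S T) = a"
    using ak by (auto simp: b_def fun_eq_iff)
qed

lemma finite_top_rows: "T \<subseteq> {..<N} \<Longrightarrow> finite (top_rows N k T)"
proof (induction k arbitrary: T)
  case 0
  then show ?case by (simp add: top_rows_0)
next
  case (Suc k)
  have "top_rows N (Suc k) T \<subseteq> (\<Union>S\<in>Pow {..<N}. (\<lambda>b. b(k := next_row S T)) ` top_rows N k S)"
  proof
    fix a assume "a \<in> top_rows N (Suc k) T"
    note r = top_rows_Suc_restrict[OF this Suc.prems]
    show "a \<in> (\<Union>S\<in>Pow {..<N}. (\<lambda>b. b(k := next_row S T)) ` top_rows N k S)"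
      using r(1,2) r(5)[symmetric] by blast
  qed
  moreover have "finite \<dots>"
    using Suc.IH by auto
  ultimately show ?case by (rule finite_subset)
qed

lemma weight_Suc:
  assumes T: "T \<subseteq> {..<N}" "card T = Suc k"
  shows "weight N (Suc k) T =
    (\<Sum>S | S \<subseteq> {..<N} \<and> card S = k \<and> interlacing S T. 2 ^ card (S - T) * weight N k S)"
proof -
  let ?P = "{S. S \<subseteq> {..<N} \<and> card S = k \<and> interlacing S T}"
  have "weight N (Suc k) T =
      (\<Sum>(S, b)\<in>Sigma ?P (top_rows N k). 2 ^ card (S - T) * 2 ^ card (negatives b))"
    unfolding weight_def
  proof (rule sum.reindex_bij_witness[where i = "\<lambda>(S, b). b(k := next_row S T)" and
        j = "\<lambda>a. (column_set N k a, a(k := \<lambda>_. 0))"])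
    fix a assume "a \<in> top_rows N (Suc k) T"
    note r = top_rows_Suc_restrict[OF this T(1)]
    show "(case (column_set N k a, a(k := \<lambda>_. 0)) of (S, b) \<Rightarrow> b(k := next_row S T)) = a"
      using r(5) by simp
    show "(column_set N k a, a(k := \<lambda>_. 0)) \<in> Sigma ?P (top_rows N k)"
      using r by simp
    show "(case (column_set N k a, a(k := \<lambda>_. 0)) of (S, b) \<Rightarrow> 2 ^ card (S - T) * 2 ^ card (negatives b)) =
        (2 ^ card (negatives a) :: rat)"
      using top_rows_Suc_extend(4)[OF r(2,1) T r(4)] r(5) by (simp add: power_add)
  next
    fix p assume "p \<in> Sigma ?P (top_rows N k)"
    then obtain S b where p: "p = (S, b)" "S \<subseteq> {..<N}" "interlacing S T" "b \<in> top_rows N k S" by auto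
    note e = top_rows_Suc_extend[OF p(4,2) T p(3)]
    show "(case p of (S, b) \<Rightarrow> b(k := next_row S T)) \<in> top_rows N (Suc k) T"
      using e(1) p by simp
    show "(column_set N k (case p of (S, b) \<Rightarrow> b(k := next_row S T)),
        (case p of (S, b) \<Rightarrow> b(k := next_row S T))(k := \<lambda>_. 0)) = p"
      using e(2,3) p by simp
  qed
  also have "\<dots> = (\<Sum>S\<in>?P. \<Sum>b\<in>top_rows N k S. 2 ^ card (S - T) * 2 ^ card (negatives b))"
    by (rule sum.Sigma[symmetric]) (auto intro: finite_top_rows finite_subset[of _ "Pow {..<N}"])
  finally show ?thesis by (simp add: weight_def sum_distrib_left)
qed

lemma weight_eq_difference_product:
  assumes "T \<subseteq> {..<N}" "card T = k"
  shows "weight N k T = (\<Prod>i<k. 2 ^ i / fact i) * difference_product T"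
  using assms
proof (induction k arbitrary: T)
  case 0
  then have "T = {}" using finite_subset by fastforce
  then show ?case by (simp add: weight_def top_rows_0 negatives_def difference_product_def)
next
  case (Suc k)
  have fin: "finite T" using Suc.prems finite_subset by blast
  have "weight N (Suc k) T = (\<Sum>S | S \<subseteq> {..<N} \<and> card S = k \<and> interlacing S T. 2 ^ card (S - T) * weight N k S)"
    by (rule weight_Suc[OF Suc.prems])
  also have "\<dots> = (\<Sum>S | S \<subseteq> {..<N} \<and> card S = k \<and> interlacing S T.
      (\<Prod>i<k. 2 ^ i / fact i) * (2 ^ card (S - T) * difference_product S))"
    by (intro sum.cong) (auto simp: Suc.IH)
  \<comment> \<open>The bound \<open>N\<close> on \<open>S\<close> follows from interlacing, since
    no element of \<open>S\<close> exceeds the largest element of \<open>T\<close>.\<close>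
  also have "{S. S \<subseteq> {..<N} \<and> card S = k \<and> interlacing S T} = {S. finite S \<and> card S = k \<and> interlacing S T}"
  proof -
    have "S \<subseteq> {..<N}" if S: "finite S" "card S = k" "interlacing S T" for S
    proof
      fix s assume "s \<in> S"
      then obtain i where i: "i < k" "s = enum S i" using enum_image[OF S(1)] S by auto
      then have "s \<le> enum T (Suc i)" using interlacing_iff_enum S fin Suc.prems by auto
      also have "\<dots> < N" using enum_mem[OF fin, of "Suc i"] i Suc.prems by auto
      finally show "s \<in> {..<N}" by simp
    qed
    then show ?thesis using finite_subset by blast
  qed
  finally show ?case
    using sum_interlacing_difference_product[OF fin Suc.prems(2)]
    by (simp add: sum_distrib_left[symmetric])
qed

section \<open>Half-turn symmetry\<close>

lemma sum_lessThan_reverse: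
  fixes f :: "nat \<Rightarrow> 'a::ab_group_add"
  assumes "l \<le> n"
  shows "(\<Sum>j<l. f (n - 1 - j)) = (\<Sum>j<n. f j) - (\<Sum>j<n - l. f j)"
  using assms
proof (induction l)
  case (Suc l)
  then have "n - l = Suc (n - 1 - l)" by simp
  then have "(\<Sum>j<n - l. f j) = (\<Sum>j<n - Suc l. f j) + f (n - 1 - l)" by simp
  then show ?case using Suc by (simp add: algebra_simps)
qed simp

text \<open>Column \<open>n - 1 - j\<close> read from the top is column \<open>j\<close> read from
  the bottom.\<close>

lemma half_turn_column_prefix:
  fixes g :: "nat \<Rightarrow> nat \<Rightarrow> int"
  assumes "\<And>i. i < n \<Longrightarrow> g i (n - 1 - j) = g (n - 1 - i) j" "l \<le> n"
  shows "(\<Sum>i<l. g i (n - 1 - j)) = (\<Sum>i<n. g i j) - (\<Sum>i<n - l. g i j)"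
proof -
  have "(\<Sum>i<l. g i (n - 1 - j)) = (\<Sum>i<l. g (n - 1 - i) j)"
    using assms by (intro sum.cong) auto
  then show ?thesis using sum_lessThan_reverse[OF assms(2), of "\<lambda>i. g i j"] by simp
qed

lemma half_turn_column_sum:
  fixes g :: "nat \<Rightarrow> nat \<Rightarrow> int"
  assumes "\<And>i. i < n \<Longrightarrow> g i (n - 1 - j) = g (n - 1 - i) j"
  shows "(\<Sum>i<n. g i j) = (\<Sum>i<n div 2. g i j) + (if odd n then g (n div 2) j else 0) +
    (\<Sum>i<n div 2. g i (n - 1 - j))"
proof (cases "even n")
  case True
  then have "n - n div 2 = n div 2" by auto
  then show ?thesis using half_turn_column_prefix[of n g j "n div 2", OF assms] True by simp
next
  case False
  then have "n - n div 2 = Suc (n div 2)" by presburger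
  then show ?thesis using half_turn_column_prefix[of n g j "n div 2", OF assms] False by simp
qed

text \<open>When \<open>T\<close> is the set of columns with partial sum 1 after the first \<open>n div 2\<close> rows of a
  half-turn symmetric matrix, this is the middle row if \<open>n\<close> is odd, and it has to vanish if
  \<open>n\<close> is even.\<close>

definition middle :: "nat \<Rightarrow> nat set \<Rightarrow> nat \<Rightarrow> int" where
  "middle n T j = 1 - of_bool (j \<in> T) - of_bool (n - 1 - j \<in> T)"

text \<open>The value \<open>int (n mod 2)\<close> serves both parities: for odd \<open>n\<close>
  the middle row has to be alternating, for even \<open>n\<close> all its prefix sums, and so all
  entries, have to vanish.\<close>

definition half_sets :: "nat \<Rightarrow> nat set set" where
  "half_sets n = {T. T \<subseteq> {..<n} \<and> card T = n div 2 \<and>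
     (\<forall>l\<le>n. (\<Sum>j<l. middle n T j) \<in> {0, int (n mod 2)})}"

text \<open>The bound \<open>2 * j < n\<close> keeps one of the columns \<open>j\<close> and
  \<open>n - 1 - j\<close>, and the central column for odd \<open>n\<close>, so that orbits are
  counted and not entries.\<close>

definition middle_negatives :: "nat \<Rightarrow> nat set \<Rightarrow> nat set" where
  "middle_negatives n T = {j. 2 * j < n \<and> middle n T j = -1}"

lemma middle_reverse: "j < n \<Longrightarrow> middle n T (n - 1 - j) = middle n T j"
  by (simp add: middle_def)

lemma middle_even:
  assumes "T \<in> half_sets n" "even n" "j < n"
  shows "middle n T j = 0"
proof -
  have "(\<Sum>j<l. middle n T j) = 0" if "l \<le> n" for l
    using assms that by (fastforce simp: half_sets_def)
  from this[of j] this[of "Suc j"] assms(3) show ?thesis by simp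
qed

lemma sum_middle:
  assumes "T \<subseteq> {..<n}"
  shows "(\<Sum>j<n. middle n T j) = int n - 2 * int (card T)"
proof -
  have "(\<Sum>j<n. of_bool (j \<in> T)) = int (card T)"
    using assms by (simp add: sum.If_cases of_bool_def Int_absorb1)
  moreover have "(\<Sum>j<n. of_bool (n - 1 - j \<in> T)) = (\<Sum>j<n. of_bool (j \<in> T) :: int)"
    using sum_lessThan_reverse[of n n "\<lambda>j. of_bool (j \<in> T) :: int"] by simp
  ultimately show ?thesis by (simp add: middle_def sum_subtractf)
qed

section \<open>Rebuilding an invariant matrix from its top rows\<close>

definition unfold_rows :: "nat \<Rightarrow> nat set \<Rightarrow> (nat \<Rightarrow> nat \<Rightarrow> int) \<Rightarrow> nat \<Rightarrow> nat \<Rightarrow> int" where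
  "unfold_rows n T a i j =
     (if i < n div 2 then a i j
      else if n - 1 - i < n div 2 then a (n - 1 - i) (n - 1 - j)
      else middle n T j)"

definition fold_rows :: "nat \<Rightarrow> int mat \<Rightarrow> nat \<Rightarrow> nat \<Rightarrow> int" where
  "fold_rows n A i j = (if i < n div 2 \<and> j < n then A $$ (i, j) else 0)"

lemma unfold_rows_half_turn:
  assumes "i < n" "j < n"
  shows "unfold_rows n T a (n - 1 - i) (n - 1 - j) = unfold_rows n T a i j"
proof -
  have "\<not> (i < n div 2 \<and> n - 1 - i < n div 2)" using assms by auto
  then show ?thesis using assms by (auto simp: unfold_rows_def middle_def)
qed

context
  fixes n :: nat and T :: "nat set" and a :: "nat \<Rightarrow> nat \<Rightarrow> int"
  assumes T: "T \<in> half_sets n" and a: "a \<in> top_rows n (n div 2) T"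
begin

private lemma T_sub: "T \<subseteq> {..<n}" and card_T: "card T = n div 2"
  and T_prefix: "l \<le> n \<Longrightarrow> (\<Sum>j<l. middle n T j) \<in> {0, int (n mod 2)}"
  using T unfolding half_sets_def by blast+

private lemma a_supp: "a i j \<noteq> 0 \<Longrightarrow> i < n div 2 \<and> j < n"
  and a_row: "i < n div 2 \<Longrightarrow> (\<Sum>j<n. a i j) = 1"
  and a_row_prefix: "i < n div 2 \<Longrightarrow> l \<le> n \<Longrightarrow> (\<Sum>j<l. a i j) \<in> {0, 1}"
  and a_col_prefix: "j < n \<Longrightarrow> l \<le> n div 2 \<Longrightarrow> (\<Sum>i<l. a i j) \<in> {0, 1}"
  and a_col: "j < n \<Longrightarrow> (\<Sum>i<n div 2. a i j) = of_bool (j \<in> T)"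
  using a unfolding top_rows_def by blast+

private abbreviation "g \<equiv> unfold_rows n T a"

private lemma g_top: "i < n div 2 \<Longrightarrow> g i j = a i j"
  by (simp add: unfold_rows_def)

private lemma g_middle: "odd n \<Longrightarrow> g (n div 2) j = middle n T j"
  by (auto simp: unfold_rows_def elim!: oddE)

private lemma row_cases:
  assumes "i < n"
  obtains "i < n div 2" | "n - 1 - i < n div 2" "\<not> i < n div 2" | "odd n" "i = n div 2"
  using assms by (cases "even n"; cases "i < n div 2"; cases "n - 1 - i < n div 2") (auto elim!: evenE oddE)

private lemma g_row_prefix:
  assumes "i < n" "l \<le> n"
  shows "(\<Sum>j<l. g i j) \<in> {0, 1}" "(\<Sum>j<n. g i j) = 1"
proof -
  have "(\<Sum>j<l. g i j) \<in> {0, 1} \<and> (\<Sum>j<n. g i j) = 1"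
    using assms(1)
  proof (cases i rule: row_cases)
    case 1
    then show ?thesis using a_row a_row_prefix assms by (simp add: g_top)
  next
    case 2
    let ?i = "n - 1 - i"
    \<comment> \<open>The prefix sums of a reversed row are 1 minus prefix sums of the original one,
      which preserves the range \<open>{0, 1}\<close>.\<close>
    have "(\<Sum>j<k. g i j) = 1 - (\<Sum>j<n - k. a ?i j)" if "k \<le> n" for k
    proof -
      have "(\<Sum>j<k. g i j) = (\<Sum>j<k. a ?i (n - 1 - j))"
        using 2 by (simp add: unfold_rows_def)
      also have "\<dots> = (\<Sum>j<n. a ?i j) - (\<Sum>j<n - k. a ?i j)"
        by (rule sum_lessThan_reverse[OF that])
      finally show ?thesis using a_row[OF 2(1)] by simp
    qed
    from this[OF assms(2)] this[of n] show ?thesis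
      using a_row_prefix[OF 2(1), of "n - l"] by auto
  next
    case 3
    then have "int n - 2 * int (card T) = 1" "n mod 2 = 1"
      by (auto simp: card_T elim!: oddE)
    then show ?thesis
      using 3 sum_middle[OF T_sub] T_prefix[OF assms(2)] by (simp add: g_middle)
  qed
  then show "(\<Sum>j<l. g i j) \<in> {0, 1}" "(\<Sum>j<n. g i j) = 1" by auto
qed

private lemma g_sym: "i < n \<Longrightarrow> j < n \<Longrightarrow> g i (n - 1 - j) = g (n - 1 - i) j"
  using unfold_rows_half_turn[of i n "n - 1 - j" T a] by simp

private lemma g_col: "j < n \<Longrightarrow> (\<Sum>i<n. g i j) = 1"
proof -
  assume j: "j < n"
  have top: "(\<Sum>i<n div 2. g i j) = of_bool (j \<in> T)" if "j < n" for j
    using a_col[OF that] by (simp add: g_top)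
  \<comment> \<open>For even \<open>n\<close> there is no middle row, and \<open>middle\<close>
    vanishes by \<open>middle_even\<close>; so one formula covers both parities.\<close>
  have "(if odd n then g (n div 2) j else 0) = middle n T j"
    using middle_even[OF T] g_middle j by auto
  then show ?thesis
    using half_turn_column_sum[of n g j, OF g_sym[OF _ j]] j top[of j] top[of "n - 1 - j"]
    by (simp add: middle_def)
qed

private lemma g_col_prefix:
  assumes "j < n" "l \<le> n"
  shows "(\<Sum>i<l. g i j) \<in> {0, 1}"
proof (cases "l \<le> n div 2")
  case True
  then have "(\<Sum>i<l. g i j) = (\<Sum>i<l. a i j)" by (intro sum.cong) (auto simp: g_top)
  then show ?thesis using a_col_prefix[OF assms(1) True] by simp
next
  case False
  then have le: "n - l \<le> n div 2" by linarith
  \<comment> \<open>A prefix longer than half a column is 1 minus a prefix of the opposite column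
    that stays within the top rows.\<close>
  have "(\<Sum>i<n - l. g i (n - 1 - j)) = 1 - (\<Sum>i<l. g i j)"
    using half_turn_column_prefix[of n g j "n - l", OF g_sym[OF _ assms(1)]] assms g_col[OF assms(1)] by simp
  moreover have "(\<Sum>i<n - l. g i (n - 1 - j)) = (\<Sum>i<n - l. a i (n - 1 - j))"
    using le by (intro sum.cong) (auto simp: g_top)
  moreover have "(\<Sum>i<n - l. a i (n - 1 - j)) \<in> {0, 1}"
    using a_col_prefix[of "n - 1 - j" "n - l"] le assms by simp
  ultimately show ?thesis by auto
qed

private abbreviation "M \<equiv> mat n n (\<lambda>(i, j). g i j)"

lemma unfold_rows_half_turn_ASM: "M \<in> half_turn_ASMs n"
proof -
  have "alternating_sign_matrix n M"
    unfolding alternating_sign_matrix_iff_prefix_sums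
  proof (intro conjI allI impI)
    fix i l assume il: "i < n" "l \<le> n"
    have "(\<Sum>j<l. M $$ (i, j)) = (\<Sum>j<l. g i j)" using il by (intro sum.cong) auto
    then show "(\<Sum>j<l. M $$ (i, j)) \<in> {0, 1}" using g_row_prefix(1)[OF il] by simp
  next
    fix j l assume jl: "j < n" "l \<le> n"
    have "(\<Sum>i<l. M $$ (i, j)) = (\<Sum>i<l. g i j)" using jl by (intro sum.cong) auto
    then show "(\<Sum>i<l. M $$ (i, j)) \<in> {0, 1}" using g_col_prefix[OF jl] by simp
  qed (use g_row_prefix(2) g_col in auto)
  then show ?thesis
    unfolding half_turn_ASMs_def by (auto simp: half_turn_def unfold_rows_half_turn[simplified])
qed

lemma fold_unfold_rows: "fold_rows n M = a"
proof (intro ext)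
  fix i j
  show "fold_rows n M i j = a i j"
    using a_supp[of i j] by (auto simp: fold_rows_def g_top)
qed

lemma column_set_top_rows: "column_set n (n div 2) a = T"
  using T_sub a_col by (auto simp: column_set_def)

lemma minus_one_orbits_unfold_rows:
  "minus_one_orbits n M = card (negatives a) + card (middle_negatives n T)"
proof -
  let ?N = "{(i, j). i < n \<and> j < n \<and> M $$ (i, j) = -1}"
  let ?f = "\<lambda>p. {p, half_turn n p}"
  \<comment> \<open>One representative of each orbit of entries -1: those in the top rows, which the
    half-turn moves to the bottom rows, and those in the left half of the middle row including its
    centre.\<close>
  let ?R = "negatives a \<union> {n div 2} \<times> middle_negatives n T"
  have a_neg: "i < n div 2 \<and> j < n" if "(i, j) \<in> negatives a" for i j
    using a_supp[of i j] that by (auto simp: negatives_def)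
  have mid_odd: "odd n" if "j \<in> middle_negatives n T" for j
    using that middle_even[OF T, of j] by (auto simp: middle_negatives_def)
  have R_N: "p \<in> ?N" if "p \<in> ?R" for p
  proof (cases p)
    case (Pair i j)
    show ?thesis
    proof (cases "p \<in> negatives a")
      case True
      then show ?thesis using a_neg[of i j] Pair by (auto simp: negatives_def g_top)
    next
      case False
      then have "i = n div 2" "j \<in> middle_negatives n T" using that Pair by auto
      then show ?thesis using Pair mid_odd[of j] g_middle[of j]
        by (auto simp: middle_negatives_def)
    qed
  qed
  have "?f ` ?N = ?f ` ?R"
  proof (intro equalityI subsetI)
    fix P assume "P \<in> ?f ` ?N"
    then obtain i j where P: "P = ?f (i, j)" and ij: "i < n" "j < n" "g i j = -1" by auto
    have swap: "?f (n - 1 - i, n - 1 - j) = ?f (i, j)"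
      using ij by (auto simp: half_turn_def)
    have neg: "g (n - 1 - i) (n - 1 - j) = -1"
      using ij unfold_rows_half_turn by simp
    show "P \<in> ?f ` ?R"
      using ij(1)
    proof (cases i rule: row_cases)
      case 1
      then show ?thesis using ij P by (intro image_eqI[of _ _ "(i, j)"]) (auto simp: negatives_def g_top)
    next
      case 2
      then show ?thesis using neg swap P
        by (intro image_eqI[of _ _ "(n - 1 - i, n - 1 - j)"]) (auto simp: negatives_def g_top)
    next
      case 3
      then have mid: "n - 1 - i = i" "middle n T j = -1"
        using ij g_middle by (auto elim!: oddE)
      show ?thesis
      proof (cases "2 * j < n")
        case True
        then show ?thesis using 3 mid P
          by (intro image_eqI[of _ _ "(i, j)"]) (auto simp: middle_negatives_def)
      next
        case False
        then have "n - 1 - j \<in> middle_negatives n T"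
          using mid(2) middle_reverse[OF ij(2)] ij by (auto simp: middle_negatives_def)
        then show ?thesis using 3 mid(1) P swap
          by (intro image_eqI[of _ _ "(n - 1 - i, n - 1 - j)"]) auto
      qed
    qed
  qed (use R_N in blast)
  then have "minus_one_orbits n M = card (?f ` ?R)"
    by (simp add: minus_one_orbits_def)
  also have "\<dots> = card ?R"
  proof (rule card_image, rule inj_onI)
    fix p q assume pq: "p \<in> ?R" "q \<in> ?R" "?f p = ?f q"
    obtain i j i' j' where ij: "p = (i, j)" "q = (i', j')" by (cases p, cases q)
    have R: "i < n div 2 \<or> odd n \<and> i = n div 2 \<and> 2 * j < n" if "(i, j) \<in> ?R" for i j
      using that a_neg[of i j] mid_odd[of j] by (auto simp: middle_negatives_def)
    have "i < n div 2 \<or> odd n \<and> i = n div 2 \<and> 2 * j < n" "i' < n div 2 \<or> odd n \<and> i' = n div 2 \<and> 2 * j' < n"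
      using R[of i j] R[of i' j'] pq ij by blast+
    moreover have "j < n" "j' < n" using R_N pq ij by auto
    moreover have "p = q \<or> (i = n - 1 - i' \<and> j = n - 1 - j')"
      using pq(3) ij by (auto simp: half_turn_def doubleton_eq_iff)
    ultimately show "p = q" using ij by (auto elim!: oddE)
  qed
  also have "\<dots> = card (negatives a) + card ({n div 2} \<times> middle_negatives n T)"
  proof (rule card_Un_disjoint)
    show "finite (negatives a)"
      by (rule finite_subset[of _ "{..<n} \<times> {..<n}"]) (use R_N in auto)
    show "finite ({n div 2} \<times> middle_negatives n T)"
      by (rule finite_subset[of _ "{n div 2} \<times> {..<n}"]) (auto simp: middle_negatives_def)
    show "negatives a \<inter> {n div 2} \<times> middle_negatives n T = {}"
      using a_neg by auto
  qed
  finally show ?thesis by (simp add: card_cartesian_product)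
qed

end

lemma half_turn_ASM_fold_rows:
  assumes A: "A \<in> half_turn_ASMs n"
  defines "a \<equiv> fold_rows n A"
  defines "T \<equiv> column_set n (n div 2) a"
  shows "T \<in> half_sets n" "a \<in> top_rows n (n div 2) T" "mat n n (\<lambda>(i, j). unfold_rows n T a i j) = A"
proof -
  have asm: "alternating_sign_matrix n A"
    and sym: "\<And>i j. i < n \<Longrightarrow> j < n \<Longrightarrow> A $$ (i, j) = A $$ (n - 1 - i, n - 1 - j)"
    using A unfolding half_turn_ASMs_def half_turn_def prod.case by blast+
  have carr: "A \<in> carrier_mat n n"
    and row: "\<And>i. i < n \<Longrightarrow> (\<Sum>j<n. A $$ (i, j)) = 1"
    and col: "\<And>j. j < n \<Longrightarrow> (\<Sum>i<n. A $$ (i, j)) = 1"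
    and row_prefix: "\<And>i l. i < n \<Longrightarrow> l \<le> n \<Longrightarrow> (\<Sum>j<l. A $$ (i, j)) \<in> {0, 1}"
    and col_prefix: "\<And>j l. j < n \<Longrightarrow> l \<le> n \<Longrightarrow> (\<Sum>i<l. A $$ (i, j)) \<in> {0, 1}"
    using asm unfolding alternating_sign_matrix_iff_prefix_sums by blast+
  have a_row: "(\<Sum>j<l. a i j) = (\<Sum>j<l. A $$ (i, j))" if "i < n div 2" "l \<le> n" for i l
    using that by (intro sum.cong) (auto simp: a_def fold_rows_def)
  have a_col: "(\<Sum>i<l. a i j) = (\<Sum>i<l. A $$ (i, j))" if "j < n" "l \<le> n div 2" for j l
    using that by (intro sum.cong) (auto simp: a_def fold_rows_def)
  have T_col: "(\<Sum>i<n div 2. A $$ (i, j)) = of_bool (j \<in> T)" if "j < n" for j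
    using a_col[OF that order_refl] col_prefix[OF that, of "n div 2"] that
    by (auto simp: T_def column_set_def)
  have T_sub: "T \<subseteq> {..<n}" by (auto simp: T_def column_set_def)
  show a: "a \<in> top_rows n (n div 2) T"
    unfolding top_rows_def
  proof (intro CollectI conjI allI impI)
    fix i j assume "a i j \<noteq> 0"
    then show "i < n div 2" "j < n" by (auto simp: a_def fold_rows_def split: if_splits)
  next
    fix i assume i: "i < n div 2"
    then show "(\<Sum>j<n. a i j) = 1" using a_row[OF i] row[of i] by simp
    fix l assume "l \<le> n"
    then show "(\<Sum>j<l. a i j) \<in> {0, 1}" using a_row[OF i] row_prefix[of i l] i by simp
  next
    fix j l assume "j < n" "l \<le> n div 2"
    then show "(\<Sum>i<l. a i j) \<in> {0, 1}" using a_col[of j l] col_prefix[of j l] by simp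
  next
    fix j assume "j < n"
    then show "(\<Sum>i<n div 2. a i j) = of_bool (j \<in> T)" using a_col[of j "n div 2"] T_col[of j] by simp
  qed
  \<comment> \<open>Column sums 1 and the symmetry force the middle row to be
    \<open>middle n T\<close>; for even \<open>n\<close> they force \<open>middle n T\<close> to be
    0.\<close>
  have middle: "middle n T j = (if odd n then A $$ (n div 2, j) else 0)" if "j < n" for j
  proof -
    have "A $$ (i, n - 1 - j) = A $$ (n - 1 - i, j)" if "i < n" for i
      using sym[of i "n - 1 - j"] that \<open>j < n\<close> by simp
    from half_turn_column_sum[of n "\<lambda>i j. A $$ (i, j)" j, OF this]
    have "1 = of_bool (j \<in> T) + (if odd n then A $$ (n div 2, j) else 0) + of_bool (n - 1 - j \<in> T)"
      using col[OF that] T_col[OF that] T_col[of "n - 1 - j"] that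
      by simp
    then show ?thesis by (simp add: middle_def)
  qed
  have "(\<Sum>j<l. middle n T j) \<in> {0, int (n mod 2)}" if "l \<le> n" for l
  proof -
    have "(\<Sum>j<l. middle n T j) = (\<Sum>j<l. if odd n then A $$ (n div 2, j) else 0)"
      using that by (intro sum.cong) (auto simp: middle)
    then show ?thesis
      using row_prefix[of "n div 2" l] that by (cases "even n") (auto simp: odd_iff_mod_2_eq_one elim!: oddE)
  qed
  then show "T \<in> half_sets n"
    unfolding half_sets_def using T_sub card_top_rows[OF a T_sub] by blast
  show "mat n n (\<lambda>(i, j). unfold_rows n T a i j) = A"
  proof (intro eq_matI)
    fix i j assume "i < dim_row A" "j < dim_col A"
    then have ij: "i < n" "j < n" using carr by auto
    have "unfold_rows n T a i j = A $$ (i, j)"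
    proof (cases "i < n div 2 \<or> n - 1 - i < n div 2")
      case True
      then show ?thesis using ij sym[of i j] by (auto simp: unfold_rows_def a_def fold_rows_def)
    next
      case False
      then have "odd n" "i = n div 2" using ij by (cases "even n"; auto elim!: evenE oddE)+
      then show ?thesis using False ij middle by (simp add: unfold_rows_def)
    qed
    then show "mat n n (\<lambda>(i, j). unfold_rows n T a i j) $$ (i, j) = A $$ (i, j)" using ij by simp
  qed (use carr in auto)
qed

text \<open>Passing to the top rows and their column set is a bijection, under which the orbits
  split into those of the top rows and those of the middle row.\<close>

lemma H_eq_sum_half_sets:
  "(H n 2 1 :: rat) =
    (\<Sum>T\<in>half_sets n. 2 ^ card (middle_negatives n T) * weight n (n div 2) T)"
proof -
  let ?S = "Sigma (half_sets n) (top_rows n (n div 2))"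
  have "(H n 2 1 :: rat) = (\<Sum>A\<in>half_turn_ASMs n. 2 ^ minus_one_orbits n A)"
    by (simp add: H_def)
  also have "\<dots> = (\<Sum>(T, a)\<in>?S. 2 ^ card (middle_negatives n T) * 2 ^ card (negatives a))"
  proof (rule sum.reindex_bij_witness[where
        i = "\<lambda>(T, a). mat n n (\<lambda>(i, j). unfold_rows n T a i j)" and
        j = "\<lambda>A. (column_set n (n div 2) (fold_rows n A), fold_rows n A)"])
    fix A assume "A \<in> half_turn_ASMs n"
    note A = half_turn_ASM_fold_rows[OF this]
    show "(case (column_set n (n div 2) (fold_rows n A), fold_rows n A) of
        (T, a) \<Rightarrow> mat n n (\<lambda>(i, j). unfold_rows n T a i j)) = A"
      using A(3) by simp
    show "(column_set n (n div 2) (fold_rows n A), fold_rows n A) \<in> ?S"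
      using A by simp
    show "(case (column_set n (n div 2) (fold_rows n A), fold_rows n A) of
        (T, a) \<Rightarrow> 2 ^ card (middle_negatives n T) * 2 ^ card (negatives a)) =
        (2 ^ minus_one_orbits n A :: rat)"
      using minus_one_orbits_unfold_rows[OF A(1,2)] A(3) by (simp add: power_add)
  next
    fix p assume "p \<in> ?S"
    then obtain T a where p: "p = (T, a)" "T \<in> half_sets n" "a \<in> top_rows n (n div 2) T" by auto
    show "(case p of (T, a) \<Rightarrow> mat n n (\<lambda>(i, j). unfold_rows n T a i j)) \<in> half_turn_ASMs n"
      using unfold_rows_half_turn_ASM[OF p(2,3)] p by simp
    show "(column_set n (n div 2) (fold_rows n (case p of (T, a) \<Rightarrow> mat n n (\<lambda>(i, j). unfold_rows n T a i j))),
        fold_rows n (case p of (T, a) \<Rightarrow> mat n n (\<lambda>(i, j). unfold_rows n T a i j))) = p"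
      using fold_unfold_rows[OF p(2,3)] column_set_top_rows[OF p(2,3)] p by simp
  qed
  also have "\<dots> = (\<Sum>T\<in>half_sets n. \<Sum>a\<in>top_rows n (n div 2) T.
      2 ^ card (middle_negatives n T) * 2 ^ card (negatives a))"
    by (rule sum.Sigma[symmetric])
      (auto simp: half_sets_def intro: finite_top_rows finite_subset[of _ "Pow {..<n}"])
  finally show ?thesis by (simp add: weight_def sum_distrib_left)
qed

lemma H_eq_sum_difference_product:
  "(H n 2 1 :: rat) = (\<Prod>i<n div 2. 2 ^ i / fact i) *
    (\<Sum>T\<in>half_sets n. 2 ^ card (middle_negatives n T) * difference_product T)"
  unfolding H_eq_sum_half_sets sum_distrib_left
  by (intro sum.cong) (auto simp: half_sets_def weight_eq_difference_product)

section \<open>Odd order\<close>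

definition prefix_count :: "nat set \<Rightarrow> nat \<Rightarrow> int" where
  "prefix_count S j = (\<Sum>l<j. of_bool (l \<in> S))"

lemma prefix_count_eq_card: "prefix_count S j = int (card (S \<inter> {..<j}))"
  by (simp add: prefix_count_def sum.If_cases of_bool_def Int_commute)

lemma prefix_count_0 [simp]: "prefix_count S 0 = 0"
  by (simp add: prefix_count_def)

lemma prefix_count_Suc: "prefix_count S (Suc j) = prefix_count S j + of_bool (j \<in> S)"
  by (simp add: prefix_count_def)

lemma prefix_count_full: "S \<subseteq> {..<N} \<Longrightarrow> N \<le> j \<Longrightarrow> prefix_count S j = int (card S)"
  unfolding prefix_count_eq_card by (subst Int_absorb2) auto

lemma prefix_count_reverse:
  assumes "j \<le> N"
  shows "(\<Sum>l<j. of_bool (N - 1 - l \<in> S)) = prefix_count S N - prefix_count S (N - j)"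
  unfolding prefix_count_def
  using sum_lessThan_reverse[OF assms, of "\<lambda>l. of_bool (l \<in> S) :: int"] by simp

lemma half_step_iff_prefix_count:
  "half_step Y S \<longleftrightarrow>
    (\<forall>j. prefix_count S j \<le> prefix_count Y j \<and> prefix_count Y j \<le> prefix_count S (Suc j))"
  by (auto simp: half_step_def prefix_count_eq_card)

lemma prefix_count_transversal:
  assumes Y: "Y \<in> transversals m" and j: "j \<le> 2 * m"
  shows "prefix_count Y (2 * m - j) = int m - int j + prefix_count Y j"
proof -
  have *: "int i - prefix_count Y i = prefix_count Y (2 * m) - prefix_count Y (2 * m - i)" if "i \<le> 2 * m" for i
  proof -
    have "int i - prefix_count Y i = (\<Sum>l<i. 1 - of_bool (l \<in> Y))"
      by (simp add: prefix_count_def sum_subtractf)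
    also have "\<dots> = (\<Sum>l<i. of_bool (2 * m - 1 - l \<in> Y))"
    proof (intro sum.cong refl)
      fix l assume "l \<in> {..<i}"
      then have "l < 2 * m" using that by simp
      then have "l \<in> Y \<longleftrightarrow> 2 * m - 1 - l \<notin> Y" using Y unfolding transversals_def by blast
      then show "1 - of_bool (l \<in> Y) = (of_bool (2 * m - 1 - l \<in> Y) :: int)" by (cases "l \<in> Y") simp_all
    qed
    also have "\<dots> = prefix_count Y (2 * m) - prefix_count Y (2 * m - i)"
      by (rule prefix_count_reverse[OF that])
    finally show ?thesis .
  qed
  \<comment> \<open>At \<open>i = m\<close> the two counts up to \<open>m\<close> cancel, which
    gives the total \<open>m\<close>.\<close>
  have "prefix_count Y (2 * m) = int m" using *[of m] by simp
  then show ?thesis using *[OF j] by simp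
qed

lemma card_transversal:
  assumes "Y \<in> transversals m"
  shows "card Y = m"
proof -
  have "Y \<subseteq> {..<2 * m}" using assms unfolding transversals_def by blast
  then show ?thesis
    using prefix_count_transversal[OF assms, of 0] prefix_count_full[of Y "2 * m" "2 * m"] by simp
qed

lemma transversal_eqI:
  assumes "Y \<in> transversals m" "Y' \<in> transversals m" "\<And>j. j < m \<Longrightarrow> j \<in> Y \<longleftrightarrow> j \<in> Y'"
  shows "Y = Y'"
proof -
  have "j \<in> Y \<longleftrightarrow> j \<in> Y'" for j
  proof (cases "j < 2 * m")
    case True
    then have "j \<in> Y \<longleftrightarrow> 2 * m - 1 - j \<notin> Y" "j \<in> Y' \<longleftrightarrow> 2 * m - 1 - j \<notin> Y'"
      using assms(1,2) unfolding transversals_def by blast+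
    then show ?thesis using assms(3)[of j] assms(3)[of "2 * m - 1 - j"] True by (cases "j < m") auto
  next
    case False
    then show ?thesis using assms(1,2) unfolding transversals_def by blast
  qed
  then show ?thesis by blast
qed

lemma exists_transversal:
  "\<exists>Y\<in>transversals m. \<forall>j<m. j \<in> Y \<longleftrightarrow> P j"
proof -
  let ?Y = "{j. j < 2 * m \<and> (if j < m then P j else \<not> P (2 * m - 1 - j))}"
  have "j \<in> ?Y \<longleftrightarrow> 2 * m - 1 - j \<notin> ?Y" if "j < 2 * m" for j
    using that by auto
  then have "?Y \<in> transversals m"
    unfolding transversals_def by blast
  then show ?thesis by (intro bexI[of _ ?Y]) auto
qed

text \<open>By symmetry, \<open>half_step Y S\<close> constrains only \<open>prefix_count Y i\<close> for \<open>i \<le> m\<close>. If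
  \<open>S\<close> is in \<open>half_sets (2 * m + 1)\<close>, these counts range independently over intervals, which have two elements
  where the middle row has an entry \<open>-1\<close> and one element elsewhere.\<close>

context
  fixes m :: nat and S :: "nat set"
  assumes S: "S \<subseteq> {..<2 * m + 1}" "card S = m"
begin

private definition A :: "nat \<Rightarrow> int" where "A = prefix_count S"

text \<open>As \<open>card S = m\<close>, for \<open>j \<le> 2 * m + 1\<close> this counts the
  positions outside \<open>S\<close> among the last \<open>j\<close> of
  \<open>{..<2 * m + 1}\<close>. By \<open>sum_middle_eq\<close> the differences
  \<open>B j - A j\<close> are the prefix sums of the middle row.\<close>

private definition B :: "nat \<Rightarrow> int" where
  "B j = int j - int m + prefix_count S (2 * m + 1 - j)"

private lemma A_0: "A 0 = 0" and B_0: "B 0 = 0"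
  using prefix_count_full[OF S(1), of "2 * m + 1"] S(2) by (simp_all add: A_def B_def)

private lemma A_Suc: "A (Suc j) = A j + of_bool (j \<in> S)"
  by (simp add: A_def prefix_count_Suc)

private lemma B_Suc: "j \<le> 2 * m \<Longrightarrow> B (Suc j) = B j + 1 - of_bool (2 * m - j \<in> S)"
  using prefix_count_Suc[of S "2 * m - j"] by (simp add: B_def Suc_diff_le)

private lemma sum_middle_eq: "j \<le> 2 * m + 1 \<Longrightarrow> (\<Sum>l<j. middle (2 * m + 1) S l) = B j - A j"
  by (induction j) (simp_all add: A_0 B_0 A_Suc B_Suc middle_def)

private lemma half_step_iff:
  assumes Y: "Y \<in> transversals m"
  shows "half_step Y S \<longleftrightarrow>
    (\<forall>i\<le>m. prefix_count Y i \<in> {max (A i) (B (Suc i) - 1)..min (A (Suc i)) (B i)})"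
proof -
  let ?P = "\<lambda>j. prefix_count S j \<le> prefix_count Y j \<and> prefix_count Y j \<le> prefix_count S (Suc j)"
  have Y_sub: "Y \<subseteq> {..<2 * m}" using Y unfolding transversals_def by blast
  \<comment> \<open>The symmetry of \<open>Y\<close> turns the condition at \<open>2 * m - i\<close>
    into bounds on \<open>prefix_count Y i\<close>.\<close>
  have flip: "?P (2 * m - i) \<longleftrightarrow> B (Suc i) - 1 \<le> prefix_count Y i \<and> prefix_count Y i \<le> B i" if "i \<le> m" for i
  proof -
    have "prefix_count Y (2 * m - i) = int m - int i + prefix_count Y i"
      using prefix_count_transversal[OF Y, of i] that by simp
    moreover have "2 * m + 1 - i = Suc (2 * m - i)" "2 * m + 1 - Suc i = 2 * m - i"
      using that by auto
    then have "B i = int i - int m + prefix_count S (Suc (2 * m - i))"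
      "B (Suc i) = int i + 1 - int m + prefix_count S (2 * m - i)"
      by (simp_all add: B_def)
    ultimately show ?thesis by linarith
  qed
  have "half_step Y S \<longleftrightarrow> (\<forall>i\<le>m. ?P i \<and> ?P (2 * m - i))"
  proof (intro iffI allI impI)
    assume P: "\<forall>i\<le>m. ?P i \<and> ?P (2 * m - i)"
    show "half_step Y S"
      unfolding half_step_iff_prefix_count
    proof (rule allI)
      fix j
      consider "j \<le> m" | "m < j" "j \<le> 2 * m" | "2 * m < j" by linarith
      then show "?P j"
      proof cases
        case 2
        then have "2 * m - (2 * m - j) = j" "2 * m - j \<le> m" by auto
        then show ?thesis using P by metis
      next
        case 3
        then show ?thesis
          using prefix_count_full[OF Y_sub, of j] prefix_count_full[OF S(1), of j] prefix_count_full[OF S(1), of "Suc j"]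
            card_transversal[OF Y] S(2) by simp
      qed (use P in blast)
    qed
  qed (simp add: half_step_iff_prefix_count)
  also have "\<dots> \<longleftrightarrow> (\<forall>i\<le>m. prefix_count Y i \<in> {max (A i) (B (Suc i) - 1)..min (A (Suc i)) (B i)})"
    using flip by (auto simp: A_def)
  finally show ?thesis .
qed

private lemma half_sets_prefix:
  "S \<in> half_sets (2 * m + 1) \<longleftrightarrow> (\<forall>j\<le>2 * m + 1. B j - A j \<in> {0, 1})"
proof -
  have mod: "int ((2 * m + 1) mod 2) = 1" and "(2 * m + 1) div 2 = m" by simp_all
  moreover have "(\<Sum>j<l. middle (2 * m + 1) S j) \<in> {0, int ((2 * m + 1) mod 2)} \<longleftrightarrow> B l - A l \<in> {0, 1}"
    if "l \<le> 2 * m + 1" for l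
    unfolding sum_middle_eq[OF that] mod ..
  ultimately show ?thesis
    unfolding half_sets_def mem_Collect_eq using S by metis
qed

private lemma half_sets_iff: "S \<in> half_sets (2 * m + 1) \<longleftrightarrow> (\<forall>j\<le>m. B j - A j \<in> {0, 1})"
proof -
  \<comment> \<open>The middle row is symmetric with sum 1, so complementary prefix sums add up to 1
    and the range up to \<open>m\<close> determines the rest.\<close>
  have "B (2 * m + 1 - j) - A (2 * m + 1 - j) = 1 - (B j - A j)" if "j \<le> 2 * m + 1" for j
    using that by (simp add: A_def B_def of_nat_diff)
  then have flip: "B j - A j = 1 - (B (2 * m + 1 - j) - A (2 * m + 1 - j))" if "j \<le> 2 * m + 1" for j
    using that by simp
  have "S \<in> half_sets (2 * m + 1) \<longleftrightarrow> (\<forall>j\<le>2 * m + 1. B j - A j \<in> {0, 1})"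
    by (rule half_sets_prefix)
  also have "\<dots> \<longleftrightarrow> (\<forall>j\<le>m. B j - A j \<in> {0, 1})"
  proof (intro iffI allI impI)
    fix j assume le: "\<forall>j\<le>m. B j - A j \<in> {0, 1}" "j \<le> 2 * m + 1"
    show "B j - A j \<in> {0, 1}"
    proof (cases "j \<le> m")
      case False
      then have "2 * m + 1 - j \<le> m" by simp
      then have "B (2 * m + 1 - j) - A (2 * m + 1 - j) \<in> {0, 1}" using le by blast
      then show ?thesis using flip[OF le(2)] by auto
    qed (use le in blast)
  qed simp
  finally show ?thesis .
qed

lemma card_half_step_transversals:
  "card {Y \<in> transversals m. half_step Y S} =
    (if S \<in> half_sets (2 * m + 1) then 2 ^ card (middle_negatives (2 * m + 1) S) else 0)"
proof (cases "S \<in> half_sets (2 * m + 1)")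
  case False
  have "S \<in> half_sets (2 * m + 1)" if Y: "Y \<in> transversals m" "half_step Y S" for Y
  proof -
    have box: "A i \<le> prefix_count Y i" "B (Suc i) - 1 \<le> prefix_count Y i"
      "prefix_count Y i \<le> A (Suc i)" "prefix_count Y i \<le> B i" if "i \<le> m" for i
      using half_step_iff[OF Y(1)] Y(2) that by auto
    have "B j - A j \<in> {0, 1}" if "j \<le> m" for j
    proof (cases j)
      case 0
      then show ?thesis by (simp add: A_0 B_0)
    next
      case (Suc i)
      \<comment> \<open>The count of \<open>Y\<close> at \<open>j\<close> lies between
        \<open>A j\<close> and \<open>B j\<close>, the count at \<open>i\<close> between
        \<open>B j - 1\<close> and \<open>A j\<close>.\<close>
      then have "A j \<le> B j" "B j - 1 \<le> A j"
        using box(1,4)[OF that] box(2,3)[of i] that by auto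
      then show ?thesis by auto
    qed
    then show ?thesis using half_sets_iff by blast
  qed
  then have "{Y \<in> transversals m. half_step Y S} = {}" using False by blast
  then show ?thesis using False by (simp only: card.empty if_False)
next
  case True
  define I where "I i = {max (A i) (B (Suc i) - 1)..min (A (Suc i)) (B i)}" for i
  have good: "B j - A j \<in> {0, 1}" if "j \<le> Suc m" for j
    using True[unfolded half_sets_prefix] that by simp
  have "bij_betw (\<lambda>Y. restrict (prefix_count Y) {..m}) {Y \<in> transversals m. half_step Y S} (PiE {..m} I)"
    (is "bij_betw ?F ?Ys ?H")
  proof (rule bij_betw_imageI)
    show "inj_on ?F ?Ys"
    proof (rule inj_onI)
      fix Y Y' assume Y: "Y \<in> ?Ys" "Y' \<in> ?Ys" "?F Y = ?F Y'"
      then have eq: "prefix_count Y j = prefix_count Y' j" if "j \<le> m" for j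
        using that by (metis atMost_iff restrict_apply')
      show "Y = Y'"
      proof (rule transversal_eqI[of _ m])
        fix j assume "j < m"
        then show "j \<in> Y \<longleftrightarrow> j \<in> Y'"
          using eq[of j] eq[of "Suc j"] by (auto simp: prefix_count_Suc of_bool_def split: if_splits)
      qed (use Y in auto)
    qed
    show "?F ` ?Ys = ?H"
    proof (intro equalityI subsetI)
      fix h assume "h \<in> ?F ` ?Ys"
      then obtain Y where "h = ?F Y" "Y \<in> transversals m" "half_step Y S" by blast
      then show "h \<in> ?H" using half_step_iff[of Y] by (simp add: restrict_PiE_iff I_def)
    next
      fix h assume h: "h \<in> ?H"
      then have box: "A i \<le> h i" "B (Suc i) - 1 \<le> h i" "h i \<le> A (Suc i)" "h i \<le> B i" if "i \<le> m" for i
        using that by (auto simp: PiE_iff I_def)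
      obtain Y where Y: "Y \<in> transversals m" "\<And>j. j < m \<Longrightarrow> j \<in> Y \<longleftrightarrow> h (Suc j) = h j + 1"
        using exists_transversal[of m "\<lambda>j. h (Suc j) = h j + 1"] by blast
      have count: "prefix_count Y i = h i" if "i \<le> m" for i
        using that
      proof (induction i)
        case 0
        then show ?case using box[of 0] by (simp add: A_0 B_0)
      next
        case (Suc i)
        \<comment> \<open>The bounds chain to \<open>h i \<le> A (Suc i) \<le> h (Suc i) \<le> B
          (Suc i) \<le> h i + 1\<close>. Hence any choice of values in the intervals comes from a
          transversal.\<close>
        then have "h (Suc i) = h i \<or> h (Suc i) = h i + 1"
          using box[of i] box[of "Suc i"] by auto
        then show ?case using Suc Y(2)[of i] by (auto simp: prefix_count_Suc)
      qed
      then have "half_step Y S"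
        unfolding half_step_iff[OF Y(1)] using h by (auto simp: PiE_iff I_def)
      moreover have "?F Y = h"
        using h count by (auto simp: fun_eq_iff PiE_iff extensional_def)
      ultimately show "h \<in> ?F ` ?Ys" using Y(1) by blast
    qed
  qed
  then have "card ?Ys = card ?H" by (rule bij_betw_same_card)
  also have "\<dots> = (\<Prod>i\<le>m. card (I i))"
    by (simp add: card_PiE)
  also have "\<dots> = (\<Prod>i\<le>m. if middle (2 * m + 1) S i = -1 then 2 else 1)"
  proof (intro prod.cong refl)
    fix i assume "i \<in> {..m}"
    then have "i \<le> m" by simp
    then have "A (Suc i) = A i + of_bool (i \<in> S)" "B (Suc i) = B i + 1 - of_bool (2 * m - i \<in> S)"
      "B i = A i \<or> B i = A i + 1" "B (Suc i) = A (Suc i) \<or> B (Suc i) = A (Suc i) + 1"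
      using A_Suc[of i] B_Suc[of i] good[of i] good[of "Suc i"] by auto
    \<comment> \<open>If \<open>i\<close> and \<open>2 * m - i\<close> both lie in \<open>S\<close>,
      then \<open>B i = A i + 1\<close> and the interval is \<open>{A i..A i + 1}\<close>; in all
      other cases it is a single point.\<close>
    then show "card (I i) = (if middle (2 * m + 1) S i = -1 then 2 else 1)"
      by (cases "i \<in> S"; cases "2 * m - i \<in> S") (auto simp: I_def middle_def)
  qed
  also have "\<dots> = 2 ^ card {i \<in> {..m}. middle (2 * m + 1) S i = -1}"
    by (simp add: prod.If_cases Int_def)
  also have "{i \<in> {..m}. middle (2 * m + 1) S i = -1} = middle_negatives (2 * m + 1) S"
    by (auto simp: middle_negatives_def)
  finally show ?thesis using True by simp
qed

end

text \<open>Double counting of the pairs with \<open>half_step Y S\<close>, weighted by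
  \<open>difference_product S\<close>: for fixed \<open>Y\<close> by
  \<open>sum_half_step_difference_product\<close>, for fixed \<open>S\<close> by
  \<open>card_half_step_transversals\<close>.\<close>

lemma sum_half_sets_odd:
  "(\<Sum>S\<in>half_sets (2 * m + 1). 2 ^ card (middle_negatives (2 * m + 1) S) * difference_product S) =
    2 ^ m * (\<Sum>Y\<in>transversals m. difference_product Y)"
proof -
  let ?X = "{S. S \<subseteq> {..<2 * m + 1} \<and> card S = m}"
  have "finite ?X"
    by (rule finite_subset[of _ "Pow {..<2 * m + 1}"]) auto
  moreover have "transversals m \<subseteq> Pow {..<2 * m}"
    unfolding transversals_def by blast
  then have "finite (transversals m)"
    by (rule finite_subset) simp
  ultimately have fin: "finite ?X" "finite (transversals m)" .
  have "2 ^ m * difference_product Y = (\<Sum>S\<in>?X. if half_step Y S then difference_product S else 0)"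
    if Y: "Y \<in> transversals m" for Y
  proof -
    have Y_sub: "Y \<subseteq> {..<2 * m}" using Y unfolding transversals_def by blast
    have "card Y = m" by (rule card_transversal[OF Y])
    have "finite Y" using Y_sub finite_subset by blast
    have "2 ^ m * difference_product Y = (\<Sum>S | finite S \<and> card S = m \<and> half_step Y S. difference_product S)"
      by (rule sum_half_step_difference_product[symmetric]) fact+
    \<comment> \<open>A half step moves an element of \<open>{..<2 * m}\<close> at most to
      \<open>2 * m\<close>, so all these \<open>S\<close> belong to \<open>?X\<close>.\<close>
    also have "{S. finite S \<and> card S = m \<and> half_step Y S} = {S \<in> ?X. half_step Y S}"
    proof -
      have "S \<subseteq> {..<2 * m + 1}" if S: "finite S" "card S = m" "half_step Y S" for S
      proof
        fix s assume "s \<in> S"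
        then obtain i where i: "i < m" "s = enum S i" using enum_image[OF S(1)] S by auto
        then have "s \<le> Suc (enum Y i)"
          using half_step_iff_enum[OF S(1,2) \<open>finite Y\<close> \<open>card Y = m\<close>] S by auto
        moreover have "enum Y i < 2 * m"
          using enum_mem[OF \<open>finite Y\<close>, of i] i \<open>card Y = m\<close> Y_sub by auto
        ultimately show "s \<in> {..<2 * m + 1}" by simp
      qed
      then show ?thesis using finite_subset by blast
    qed
    also have "(\<Sum>S\<in>{S \<in> ?X. half_step Y S}. difference_product S) =
        (\<Sum>S\<in>?X. if half_step Y S then difference_product S else 0)"
      by (rule sum.inter_filter[OF fin(1)])
    finally show ?thesis .
  qed
  then have "2 ^ m * (\<Sum>Y\<in>transversals m. difference_product Y) =
      (\<Sum>Y\<in>transversals m. \<Sum>S\<in>?X. if half_step Y S then difference_product S else 0)"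
    by (simp add: sum_distrib_left)
  also have "\<dots> = (\<Sum>S\<in>?X. \<Sum>Y\<in>transversals m. if half_step Y S then difference_product S else 0)"
    by (rule sum.swap)
  also have "\<dots> = (\<Sum>S\<in>?X. of_nat (card {Y \<in> transversals m. half_step Y S}) * difference_product S)"
    by (intro sum.cong refl, subst sum.inter_filter[OF fin(2), symmetric]) simp
  also have "\<dots> = (\<Sum>S\<in>?X. if S \<in> half_sets (2 * m + 1)
      then 2 ^ card (middle_negatives (2 * m + 1) S) * difference_product S else 0)"
    by (intro sum.cong) (auto simp: card_half_step_transversals)
  also have "\<dots> = (\<Sum>S\<in>{S \<in> ?X. S \<in> half_sets (2 * m + 1)}.
      2 ^ card (middle_negatives (2 * m + 1) S) * difference_product S)"
    by (rule sum.inter_filter[OF fin(1), symmetric])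
  also have "{S \<in> ?X. S \<in> half_sets (2 * m + 1)} = half_sets (2 * m + 1)"
    by (auto simp: half_sets_def)
  finally show ?thesis by simp
qed

section \<open>Even order\<close>

lemma half_sets_even: "half_sets (2 * m) = transversals m"
proof (intro equalityI subsetI)
  fix T assume T: "T \<in> half_sets (2 * m)"
  have "j \<in> T \<longleftrightarrow> 2 * m - 1 - j \<notin> T" if "j < 2 * m" for j
    using middle_even[OF T _ that] by (auto simp: middle_def of_bool_def split: if_splits)
  moreover have "T \<subseteq> {..<2 * m}" using T unfolding half_sets_def by blast
  ultimately show "T \<in> transversals m" unfolding transversals_def by blast
next
  fix T assume T: "T \<in> transversals m"
  have "middle (2 * m) T j = 0" if "j < 2 * m" for j
  proof -
    have "j \<in> T \<longleftrightarrow> 2 * m - 1 - j \<notin> T" using T that unfolding transversals_def by blast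
    then show ?thesis by (cases "j \<in> T") (simp_all add: middle_def)
  qed
  moreover have "T \<subseteq> {..<2 * m}" using T unfolding transversals_def by blast
  ultimately show "T \<in> half_sets (2 * m)"
    using card_transversal[OF T] by (simp add: half_sets_def)
qed

lemma sum_half_sets_even:
  "(\<Sum>T\<in>half_sets (2 * m). 2 ^ card (middle_negatives (2 * m) T) * difference_product T) =
    (\<Sum>Y\<in>transversals m. difference_product Y)"
proof -
  have "middle_negatives (2 * m) T = {}" if "T \<in> half_sets (2 * m)" for T
    using middle_even[OF that] by (auto simp: middle_negatives_def)
  then show ?thesis by (simp add: half_sets_even)
qed

section \<open>Evaluation\<close>

definition diagonal_factor :: "nat \<Rightarrow> rat" where
  "diagonal_factor j = 2 * poly (parity_poly j) (centred j)"

lemma diagonal_factor_nonzero: "diagonal_factor j \<noteq> 0"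
proof -
  have "centred j ^ 2 - centred i ^ 2 \<noteq> 0" if "i < j" for i
  proof -
    have "centred i ^ 2 < centred j ^ 2"
      using that by (intro power_strict_mono) (auto simp: centred_def)
    then show ?thesis by simp
  qed
  moreover have "centred j \<noteq> 0" by (simp add: centred_def add_nonneg_eq_0_iff)
  ultimately show ?thesis by (simp add: diagonal_factor_def poly_parity_poly)
qed

lemma H_even: "(H (2 * m) 2 1 :: rat) = (\<Prod>i<m. 2 ^ i / fact i) * (\<Prod>j<m. diagonal_factor j)"
  using H_eq_sum_difference_product[of "2 * m"]
  by (simp add: sum_half_sets_even sum_transversals diagonal_factor_def)

lemma H_odd: "(H (2 * m + 1) 2 1 :: rat) = 2 ^ m * H (2 * m) 2 1"
  using H_eq_sum_difference_product[of "2 * m + 1"] H_eq_sum_difference_product[of "2 * m"]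
    sum_half_sets_odd[of m] sum_half_sets_even[of m]
  by simp

lemma H_even_nonzero: "(H (2 * m) 2 1 :: rat) \<noteq> 0"
  by (simp add: H_even diagonal_factor_nonzero)

lemma H_even_ratio: "(H (2 * Suc m) 2 1 :: rat) / H (2 * m) 2 1 = 2 ^ m / fact m * diagonal_factor m"
  using H_even_nonzero[of m] unfolding H_even by (simp add: mult_ac)

section \<open>Closed form of the diagonal factors\<close>

lemma centred_square_diff:
  "centred j ^ 2 - centred i ^ 2 = (of_nat j - of_nat i) * (of_nat j + of_nat i + 1)"
  by (simp add: centred_def power2_eq_square algebra_simps)

lemma prod_even_descending: "(\<Prod>i<n. 2 * of_nat n - 2 * of_nat i) = (2 ^ n * fact n :: rat)"
proof -
  have "(\<Prod>i<n. 2 * of_nat n - 2 * of_nat i) = (\<Prod>i<n. 2 * of_nat (n - i) :: rat)"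
    by (intro prod.cong) (auto simp: of_nat_diff)
  also have "\<dots> = 2 ^ n * (\<Prod>i<n. of_nat (n - i))"
    by (simp only: prod.distrib prod_constant card_lessThan)
  also have "(\<Prod>i<n. of_nat (n - i)) = (fact n :: rat)"
    by (simp add: fact_prod_rev atLeast0LessThan)
  finally show ?thesis .
qed

lemma prod_odd: "(\<Prod>i<n. 2 * of_nat i + 1) * (2 ^ n * fact n) = (fact (2 * n) :: rat)"
proof (induction n)
  case (Suc n)
  have "(\<Prod>i<Suc n. 2 * of_nat i + 1) * (2 ^ Suc n * fact (Suc n)) =
      ((\<Prod>i<n. 2 * of_nat i + 1) * (2 ^ n * fact n)) * ((2 * of_nat n + 1) * (2 * (of_nat n + 1)) :: rat)"
    by (simp add: algebra_simps)
  also have "\<dots> = fact (2 * n) * ((2 * of_nat n + 1) * (2 * (of_nat n + 1)))"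
    by (simp only: Suc.IH)
  also have "\<dots> = fact (2 * Suc n)"
    by (simp add: algebra_simps)
  finally show ?case .
qed simp

text \<open>For \<open>n > 0\<close>, the product of the odd numbers from \<open>2 * n + 1\<close>
  to \<open>4 * n - 1\<close>, a quotient of two odd double factorials.\<close>

definition odd_product :: "nat \<Rightarrow> rat" where
  "odd_product n = (\<Prod>i<n. 2 * of_nat (n + i) + 1)"

lemma odd_product_eq: "odd_product n = fact (4 * n) * fact n / (2 ^ n * fact (2 * n) ^ 2)"
proof -
  have split: "(\<Prod>i<n + k. 2 * of_nat i + 1) = (\<Prod>i<n. 2 * of_nat i + 1) * (\<Prod>i<k. 2 * of_nat (n + i) + 1 :: rat)" for k
    by (induction k) (simp_all add: mult_ac)
  have "(\<Prod>i<2 * n. 2 * of_nat i + 1) = (\<Prod>i<n. 2 * of_nat i + 1) * odd_product n"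
    using split[of n, folded odd_product_def mult_2] .
  moreover have "(\<Prod>i<n. 2 * of_nat i + 1) = (fact (2 * n) / (2 ^ n * fact n) :: rat)"
    by (simp add: eq_divide_eq prod_odd)
  moreover have "(\<Prod>i<2 * n. 2 * of_nat i + 1) = (fact (4 * n) / (2 ^ n * 2 ^ n * fact (2 * n)) :: rat)"
    using prod_odd[of "2 * n"] by (simp add: eq_divide_eq power_add[symmetric] mult_2[symmetric])
  ultimately have "fact (4 * n) / (2 ^ n * 2 ^ n * fact (2 * n)) = fact (2 * n) / (2 ^ n * fact n) * odd_product n"
    by simp
  then show ?thesis
    by (simp add: divide_simps power2_eq_square)
qed

text \<open>Each difference of squares splits into an even and an odd factor; the even ones give
  \<open>2 ^ n * fact n\<close>, the odd ones \<open>odd_product n\<close>.\<close>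

lemma diagonal_factor_even: "diagonal_factor (2 * n) = 2 ^ Suc n * fact n * odd_product n"
proof -
  have "{i. i < 2 * n \<and> even (2 * n + i)} = (\<lambda>i. 2 * i) ` {..<n}"
    by (auto elim!: evenE)
  moreover have "inj_on (\<lambda>i :: nat. 2 * i) {..<n}" by (auto simp: inj_on_def)
  ultimately have "diagonal_factor (2 * n) = 2 * (\<Prod>i<n. centred (2 * n) ^ 2 - centred (2 * i) ^ 2)"
    by (simp add: diagonal_factor_def poly_parity_poly prod.reindex)
  also have "\<dots> = 2 * (\<Prod>i<n. (2 * of_nat n - 2 * of_nat i) * (2 * of_nat (n + i) + 1))"
    by (simp add: centred_square_diff algebra_simps)
  also have "\<dots> = 2 * (2 ^ n * fact n * odd_product n)"
    by (simp only: prod.distrib prod_even_descending odd_product_def)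
  finally show ?thesis by simp
qed

lemma diagonal_factor_odd: "diagonal_factor (2 * k + 1) = 2 ^ k * fact k * odd_product (Suc k)"
proof -
  have "{i. i < 2 * k + 1 \<and> even (2 * k + 1 + i)} = (\<lambda>i. 2 * i + 1) ` {..<k}"
    by (auto elim!: oddE)
  moreover have "inj_on (\<lambda>i :: nat. 2 * i + 1) {..<k}" by (auto simp: inj_on_def)
  ultimately have "diagonal_factor (2 * k + 1) =
      2 * centred (2 * k + 1) * (\<Prod>i<k. centred (2 * k + 1) ^ 2 - centred (2 * i + 1) ^ 2)"
    by (simp add: diagonal_factor_def poly_parity_poly prod.reindex)
  also have "\<dots> = 2 * centred (2 * k + 1) *
      (\<Prod>i<k. (2 * of_nat k - 2 * of_nat i) * (2 * of_nat (Suc k + i) + 1))"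
    by (simp add: centred_square_diff algebra_simps)
  also have "\<dots> = 2 ^ k * fact k * ((\<Prod>i<k. 2 * of_nat (Suc k + i) + 1) * (2 * centred (2 * k + 1)))"
    unfolding prod.distrib prod_even_descending by (simp only: mult_ac)
  \<comment> \<open>The linear factor of the odd polynomial equals \<open>4 * k + 3\<close> after
    doubling, which is the last factor of \<open>odd_product (Suc k)\<close>.\<close>
  also have "2 * centred (2 * k + 1) = 2 * of_nat (Suc k + k) + 1"
    by (simp add: centred_def)
  also have "(\<Prod>i<k. 2 * of_nat (Suc k + i) + 1) * (2 * of_nat (Suc k + k) + 1) = odd_product (Suc k)"
    by (simp only: odd_product_def prod.lessThan_Suc)
  finally show ?thesis .
qed

lemma binomial_quotient:
  "of_nat ((4 * n) choose (2 * n)) / of_nat ((2 * n) choose n) =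
    (fact (4 * n) * fact n ^ 2 / fact (2 * n) ^ 3 :: rat)"
proof -
  have "of_nat ((4 * n) choose (2 * n)) = (fact (4 * n) / (fact (2 * n) * fact (2 * n)) :: rat)"
    using binomial_fact[of "2 * n" "4 * n", where ?'a = rat] by simp
  moreover have "of_nat ((2 * n) choose n) = (fact (2 * n) / (fact n * fact n) :: rat)"
    using binomial_fact[of n "2 * n", where ?'a = rat] by simp
  ultimately show ?thesis by (simp add: power2_eq_square power3_eq_cube)
qed

theorem theorem4:
  fixes n :: nat
  assumes "n > 0"
  shows "(H (4 * n) 2 1 :: rat) / H (4 * n - 2) 2 1
           = 2 ^ (2 * n - 1) * (of_nat ((4 * n) choose (2 * n)) / of_nat ((2 * n) choose n))
       \<and> (H (4 * n + 2) 2 1 :: rat) / H (4 * n) 2 1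
           = 2 ^ (2 * n + 1) * (of_nat ((4 * n) choose (2 * n)) / of_nat ((2 * n) choose n))
       \<and> (H (2 * n + 1) 2 1 :: rat) = 2 ^ n * H (2 * n) 2 1"
proof (intro conjI)
  obtain k where n: "n = Suc k" using assms by (cases n) auto
  have idx: "4 * n = 2 * Suc (2 * k + 1)" "4 * n - 2 = 2 * (2 * k + 1)" "2 * n - 1 = 2 * k + 1"
    using n by auto
  have "(H (4 * n) 2 1 :: rat) / H (4 * n - 2) 2 1 = 2 ^ (2 * k + 1) / fact (2 * k + 1) * diagonal_factor (2 * k + 1)"
    \<comment> \<open>The term \<open>4 * n\<close> also occurs inside \<open>4 * n - 2\<close>, so
      the larger term is rewritten first.\<close>
    unfolding idx(2) unfolding idx(1) by (rule H_even_ratio)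
  also have "\<dots> = 2 ^ (2 * k + 1) * (2 ^ k * fact k * odd_product n / fact (2 * k + 1))"
    unfolding diagonal_factor_odd n by simp
  also have "2 ^ k * fact k * odd_product n / fact (2 * k + 1) = fact (4 * n) * fact n ^ 2 / fact (2 * n) ^ 3"
  proof -
    have "fact (2 * n) = 2 * of_nat n * (fact (2 * k + 1) :: rat)" "fact n = of_nat n * (fact k :: rat)"
      by (simp_all add: n algebra_simps)
    then have e: "fact (2 * k + 1) = (fact (2 * n) / (2 * of_nat n) :: rat)" "fact k = (fact n / of_nat n :: rat)"
      "2 ^ k = (2 ^ n / 2 :: rat)"
      by (simp_all add: n field_simps)
    have "of_nat n \<noteq> (0 :: rat)" using assms by simp
    then show ?thesis
      unfolding e odd_product_eq by (simp add: field_simps power2_eq_square power3_eq_cube)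
  qed
  finally show "(H (4 * n) 2 1 :: rat) / H (4 * n - 2) 2 1
      = 2 ^ (2 * n - 1) * (of_nat ((4 * n) choose (2 * n)) / of_nat ((2 * n) choose n))"
    unfolding binomial_quotient idx(3) .
next
  have idx: "4 * n + 2 = 2 * Suc (2 * n)" "4 * n = 2 * (2 * n)" by auto
  have "(H (4 * n + 2) 2 1 :: rat) / H (4 * n) 2 1 = 2 ^ (2 * n) / fact (2 * n) * diagonal_factor (2 * n)"
    unfolding idx(1) unfolding idx(2) by (rule H_even_ratio)
  also have "\<dots> = 2 ^ (2 * n + 1) * (fact (4 * n) * fact n ^ 2 / fact (2 * n) ^ 3)"
    unfolding diagonal_factor_even odd_product_eq
    by (simp add: field_simps power2_eq_square power3_eq_cube)
  finally show "(H (4 * n + 2) 2 1 :: rat) / H (4 * n) 2 1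
      = 2 ^ (2 * n + 1) * (of_nat ((4 * n) choose (2 * n)) / of_nat ((2 * n) choose n))"
    unfolding binomial_quotient .
next
  show "(H (2 * n + 1) 2 1 :: rat) = 2 ^ n * H (2 * n) 2 1"
    by (rule H_odd)
qed

end
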